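(* Let $\{\mathbf{u}^\mu\}_{\mu>0}$ be a family of periodic weak solutions of the incompressible Navier–Stokes equations with viscosity $\mu$, with common initial data $\mathbf{u}_0$ and common external force $\mathbf{f}$ (as specified in the context), and suppose that this family satisfies Assumption (K41w) with exponent $\beta>0$ (as defined in the context). Then, for any $T\in(0,\infty)$ and any $\alpha\in(0,\beta/2)$, there exists $M_T>0$, depending on $\mathbf{u}_0$, $\mathbf{f}$ and $T$ but independent of $\mu>0$, such that $$\|\mathbf{u}^\mu\|_{L^2(0,T;H^{\alpha}(\mathbb{T}_P))}\le M_T<\infty .$$
   Context: Let $P>0$ and $\mathbb{T}_P=[-P/2,P/2]^3\subset\mathbb{R}^3$. A function of $\mathbf{x}\in\mathbb{R}^3$ is periodic with period $\mathbb{T}_P$ if it is invariant under $\mathbf{x}\mapsto \mathbf{x}+P\mathbf{e}_i$, $i=1,2,3$, with $(\mathbf{e}_i)$ the canonical basis. All spaces in $\mathbf{x}$ are spaces of periodic functions on $\mathbb{T}_P$. Navier–Stokes system: $\partial_t\mathbf{u}+\nabla\cdot(\mathbf{u}\otimes\mathbf{u})+\nabla p=\mu\Delta\mathbf{u}+\mathbf{f}$, $\nabla\cdot\mathbf{u}=0$ in $\mathbb{R}^3$, $\mathbf{u}|_{t=0}=\mathbf{u}_0$, where $\mathbf{u}\otimes\mathbf{u}=(u_iu_j)$, $\mathbf{u}_0\in L^2(\mathbb{T}_P)$ is periodic and $\mathbf{f}$ is periodic in $\mathbf{x}$ with $\mathbf{f}\in L^2(0,T;L^2(\mathbb{T}_P))$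 for every $T>0$; $\mathbf{u}_0$ and $\mathbf{f}$ do not depend on $\mu$. Weak solutions: for each $\mu>0$, $\mathbf{u}^\mu$ is periodic, with a corresponding periodic pressure $p^\mu$, such that for every $T>0$ the equations hold in the sense of distributions in $[0,T)\times\mathbb{R}^3$ (test functions in $C_c^\infty([0,T)\times\mathbb{R}^3)$, the initial data entering through the term at $t=0$), and: (1) $\mathbf{u}^\mu\in L^2(0,T;H^1)\cap C([0,T];L^2_w)\cap C([0,T];L^{s_1})$; (2) $\partial_t\mathbf{u}^\mu\in L^2(0,T;H^{-1})+\big(L^{s_2}(0,T;W^{-1,\frac{3s_2}{3s_2-2}})\cap L^q(0,T;L^r)\big)$; (3) $p^\mu\in L^2((0,T)\times\mathbb{T}_P)+L^{s_2}(0,T;L^{\frac{3s_2}{3s_2-2}})$; (4) $\nabla p^\mu\in L^2(0,T;H^{-1})+L^q(0,T;L^r)$, for $1\le s_1<2$, $1\le s_2<\infty$, $1\le q<2$, $r=\frac{3q}{2(2q-1)}$; (5) in the sense of distributions in $[0,T)\times\mathbb{R}^3$, $\partial_t(\tfrac12|\mathbf{u}^\mu|^2)+\nabla\cdot\big(\mathbf{u}^\mu(\tfrac12|\mathbf{u}^\mu|^2+p^\mu)\big)+\mu|\nabla\mathbf{u}^\mu|^2-\mu\Delta(\tfrac12|\mathbf{u}^\mu|^2)\le\mathbf{f}\cdot\mathbf{u}^\mu$. Here $\mathbf{v}\in C([0,T];L^2_w)$ means $\mathbf{v}\in L^\infty(0,T;L^2(\mathbb{T}_P))$ and $\mathbf{v}$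 is continuous in $t$ with values in $L^2(\mathbb{T}_P)$ with the weak topology. In particular, for every $T>0$ there is $C'_T>0$ independent of $\mu$ with $$\|\mathbf{u}^\mu-\bar{\mathbf{u}}\|_{L^\infty(0,T;L^2(\mathbb{T}_P))}^2+\|\sqrt{\mu}\,\nabla\mathbf{u}^\mu\|^2_{L^2([0,T)\times\mathbb{T}_P)}\le C'_T\big(\|\mathbf{u}_0-\bar{\mathbf{u}}\|^2_{L^2(\mathbb{T}_P)}+\|\mathbf{f}-\bar{\mathbf{f}}\|^2_{L^2([0,T)\times\mathbb{T}_P)}\big),$$ where bars denote spatial means over $\mathbb{T}_P$ (the mean $\bar{\mathbf{u}}(t)=\frac1{|\mathbb{T}_P|}\int_{\mathbb{T}_P}\mathbf{u}_0\,d\mathbf{x}+\int_0^t\bar{\mathbf{f}}(s)\,ds$ is independent of $\mu$). Fourier coefficients: $\hat{\mathbf{u}}(t,\mathbf{k})=\frac{1}{|\mathbb{T}_P|}\int_{\mathbb{T}_P}\mathbf{u}(t,\mathbf{x})e^{-i\mathbf{k}\cdot\mathbf{x}}d\mathbf{x}$ for $\mathbf{k}\in\frac{2\pi}{P}\mathbb{Z}^3$. The fractional Sobolev space $H^\alpha(\mathbb{T}_P)$ is defined through Fourier coefficients. Assumption (K41w) with exponent $\beta>0$ ($\beta$ independent of $\mu$): for any $T>0$, there exist $C_T>0$ and $k_*$ (sufficiently large), depending on $\mathbf{u}_0$ and $\mathbf{f}$ but independent of the viscosity $\mu$, such that for all $\mu>0$ $$\sup_{|\mathbf{k}|\ge k_*}\Big(|\mathbf{k}|^{3+\beta}\int_0^T|\hat{\mathbf{u}}^\mu(t,\mathbf{k})|^2dt\Big)\le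 C_T .$$ *)

theory Defs
  imports "HOL-Analysis.Analysis"
begin

type_synonym vec3 = "real^3"

section \<open>Smooth functions and test functions\<close>

primrec Ck :: "nat \<Rightarrow> ('a::euclidean_space \<Rightarrow> 'b::real_normed_vector) \<Rightarrow> bool" where
  "Ck 0 f \<longleftrightarrow> continuous_on UNIV f"
| "Ck (Suc n) f \<longleftrightarrow>
     (\<forall>x. f differentiable (at x)) \<and> (\<forall>v. Ck n (\<lambda>x. frechet_derivative f (at x) v))"

definition smooth :: "('a::euclidean_space \<Rightarrow> 'b::real_normed_vector) \<Rightarrow> bool" where
  "smooth f \<longleftrightarrow> (\<forall>n. Ck n f)"

definition test_on :: "'a::euclidean_space set \<Rightarrow> ('a \<Rightarrow> real) set" where
  "test_on U = {\<phi>. smooth \<phi> \<and> (\<exists>K. compact K \<and> K \<subseteq> U \<and> (\<forall>z. z \<notin> K \<longrightarrow> \<phi> z = 0))}"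

text \<open>The space \<open>C\<^sub>c\<^sup>\<infinity>([0,T) \<times> \<real>\<^sup>3)\<close>: its elements are the restrictions to \<open>t \<ge> 0\<close> of the
  functions below, which need not vanish at \<open>t = 0\<close>. Every use restricts to \<open>t \<ge> 0\<close>.\<close>

abbreviation st_test :: "real \<Rightarrow> (real \<times> vec3 \<Rightarrow> real) set" where
  "st_test T \<equiv> test_on ({..<T} \<times> UNIV)"

definition pd :: "3 \<Rightarrow> (vec3 \<Rightarrow> 'b::real_normed_vector) \<Rightarrow> vec3 \<Rightarrow> 'b" where
  "pd i \<psi> x = frechet_derivative \<psi> (at x) (axis i 1)"

definition dt :: "(real \<times> vec3 \<Rightarrow> real) \<Rightarrow> real \<times> vec3 \<Rightarrow> real" where
  "dt \<phi> z = frechet_derivative \<phi> (at z) (1, 0)"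

definition dx :: "3 \<Rightarrow> (real \<times> vec3 \<Rightarrow> real) \<Rightarrow> real \<times> vec3 \<Rightarrow> real" where
  "dx i \<phi> z = frechet_derivative \<phi> (at z) (0, axis i 1)"

definition laplace_x :: "(real \<times> vec3 \<Rightarrow> real) \<Rightarrow> real \<times> vec3 \<Rightarrow> real" where
  "laplace_x \<phi> z = (\<Sum>i\<in>UNIV. dx i (dx i \<phi>) z)"

section \<open>Periodic functions and their norms\<close>

definition periodic :: "real \<Rightarrow> (vec3 \<Rightarrow> 'b) \<Rightarrow> bool" where
  "periodic P v \<longleftrightarrow> (\<forall>x i. v (x + P *\<^sub>R axis i 1) = v x)"

definition cell :: "real \<Rightarrow> vec3 set" where
  "cell P = cbox (\<chi> i. - P / 2) (\<chi> i. P / 2)"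

text \<open>Functions of time and space live on \<open>t \<ge> 0\<close>. Elements of Lebesgue and Bochner spaces are
  given by jointly Borel measurable representatives that are periodic for every \<open>t\<close>; this is no
  loss of generality.\<close>

definition st_field :: "real \<Rightarrow> (real \<Rightarrow> vec3 \<Rightarrow> 'b::real_normed_vector) \<Rightarrow> bool" where
  "st_field P v \<longleftrightarrow>
     set_borel_measurable borel ({0..} \<times> UNIV) (\<lambda>z. v (fst z) (snd z)) \<and>
     (\<forall>t\<ge>0. periodic P (v t))"

text \<open>Norms take values in \<open>[0, \<infinity>]\<close>; \<open>epow\<close> is used for positive exponents only.\<close>

definition epow :: "ennreal \<Rightarrow> real \<Rightarrow> ennreal" where
  "epow x a = (if x = top then top else ennreal (enn2real x powr a))"

definition Lp_norm :: "real \<Rightarrow> real \<Rightarrow> (vec3 \<Rightarrow> 'b::real_normed_vector) \<Rightarrow> ennreal" where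
  "Lp_norm P q v = epow (\<integral>\<^sup>+x\<in>cell P. ennreal (norm (v x) powr q) \<partial>lborel) (1 / q)"

definition Lp_space :: "real \<Rightarrow> real \<Rightarrow> (vec3 \<Rightarrow> 'b::real_normed_vector) set" where
  "Lp_space P q = {v \<in> borel_measurable borel. periodic P v \<and> Lp_norm P q v < top}"

text \<open>The norm of \<open>L\<^sup>q(0,T;X)\<close>, where \<open>N\<close> is the norm of \<open>X\<close>.\<close>

definition Lt_norm :: "real \<Rightarrow> real \<Rightarrow> ('x \<Rightarrow> ennreal) \<Rightarrow> (real \<Rightarrow> 'x) \<Rightarrow> ennreal" where
  "Lt_norm q T N v = epow (\<integral>\<^sup>+t\<in>{0<..<T}. epow (N (v t)) q \<partial>lborel) (1 / q)"

definition wave_vectors :: "real \<Rightarrow> vec3 set" where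
  "wave_vectors P = {k. \<exists>m::int^3. k = (\<chi> i. 2 * pi / P * real_of_int (m $ i))}"

definition fourier :: "real \<Rightarrow> (vec3 \<Rightarrow> vec3) \<Rightarrow> vec3 \<Rightarrow> complex^3" where
  "fourier P v k =
     (\<chi> j. complex_of_real (1 / measure lborel (cell P)) *
           (LINT x:cell P|lborel. complex_of_real (v x $ j) * exp (- (\<i> * complex_of_real (k \<bullet> x)))))"

text \<open>For \<open>\<alpha> \<ge> 0\<close>; functions outside \<open>L\<^sup>2\<close> get infinite norm.\<close>

definition H_norm :: "real \<Rightarrow> real \<Rightarrow> (vec3 \<Rightarrow> vec3) \<Rightarrow> ennreal" where
  "H_norm P \<alpha> v =
     (if v \<in> Lp_space P 2
      then epow (\<Sum>\<^sub>\<infinity>k\<in>wave_vectors P.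
                   ennreal ((1 + (norm k)\<^sup>2) powr \<alpha> * (norm (fourier P v k))\<^sup>2)) (1 / 2)
      else top)"

section \<open>Sobolev spaces of order one and minus one\<close>

definition locally_integrable :: "'a::euclidean_space set \<Rightarrow> ('a \<Rightarrow> 'b::euclidean_space) \<Rightarrow> bool" where
  "locally_integrable U g \<longleftrightarrow> (\<forall>K. compact K \<and> K \<subseteq> U \<longrightarrow> set_integrable lborel K g)"

text \<open>\<open>G $ j $ i\<close> is the derivative of the \<open>j\<close>-th component in direction \<open>i\<close>.\<close>

definition weak_gradient :: "(vec3 \<Rightarrow> vec3) \<Rightarrow> (vec3 \<Rightarrow> real^3^3) \<Rightarrow> bool" where
  "weak_gradient v G \<longleftrightarrow>
     locally_integrable UNIV v \<and> locally_integrable UNIV G \<and>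
     (\<forall>\<psi>\<in>test_on UNIV. \<forall>i j.
        (LINT x|lborel. v x $ j * pd i \<psi> x) = - (LINT x|lborel. G x $ j $ i * \<psi> x))"

text \<open>\<open>v \<in> L\<^sup>2(0,T;H\<^sup>1)\<close> with spatial gradient \<open>G\<close>, which is unique up to null sets.\<close>

definition L2_H1_with_gradient ::
    "real \<Rightarrow> real \<Rightarrow> (real \<Rightarrow> vec3 \<Rightarrow> vec3) \<Rightarrow> (real \<Rightarrow> vec3 \<Rightarrow> real^3^3) \<Rightarrow> bool" where
  "L2_H1_with_gradient P T v G \<longleftrightarrow>
     st_field P v \<and> st_field P G \<and>
     (AE t in lborel. t \<in> {0<..<T} \<longrightarrow> weak_gradient (v t) (G t)) \<and>
     Lt_norm 2 T (Lp_norm P 2) v < top \<and> Lt_norm 2 T (Lp_norm P 2) G < top"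

definition per_test :: "real \<Rightarrow> (vec3 \<Rightarrow> vec3) set" where
  "per_test P = {\<psi>. smooth \<psi> \<and> periodic P \<psi>}"

definition grad :: "(vec3 \<Rightarrow> vec3) \<Rightarrow> vec3 \<Rightarrow> real^3^3" where
  "grad \<psi> x = (\<chi> j i. pd i \<psi> x $ j)"

definition divergence :: "(vec3 \<Rightarrow> vec3) \<Rightarrow> vec3 \<Rightarrow> real" where
  "divergence \<psi> x = (\<Sum>i\<in>UNIV. pd i \<psi> x $ i)"

definition W1_norm :: "real \<Rightarrow> real \<Rightarrow> (vec3 \<Rightarrow> vec3) \<Rightarrow> ennreal" where
  "W1_norm P q \<psi> = epow (epow (Lp_norm P q \<psi>) q + epow (Lp_norm P q (grad \<psi>)) q) (1 / q)"

text \<open>Periodic vector-valued distributions are linear functionals on \<open>per_test P\<close>.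
  For \<open>1 < s < \<infinity>\<close>, \<open>W\<^sup>-\<^sup>1\<^sup>,\<^sup>s\<close> is the dual of \<open>W\<^sup>1\<^sup>,\<^sup>s\<^sup>'\<close> with \<open>s' = s / (s - 1)\<close>, in which
  \<open>per_test P\<close> is dense; \<open>H\<^sup>-\<^sup>1\<close> is the case \<open>s = 2\<close>.\<close>

type_synonym functional = "(vec3 \<Rightarrow> vec3) \<Rightarrow> real"

definition linear_functional :: "real \<Rightarrow> functional \<Rightarrow> bool" where
  "linear_functional P g \<longleftrightarrow>
     (\<forall>\<psi>\<in>per_test P. \<forall>\<eta>\<in>per_test P. \<forall>a b.
        g (\<lambda>x. a *\<^sub>R \<psi> x + b *\<^sub>R \<eta> x) = a * g \<psi> + b * g \<eta>)"

definition Wneg_norm :: "real \<Rightarrow> real \<Rightarrow> functional \<Rightarrow> ennreal" where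
  "Wneg_norm P s g =
     (SUP \<psi>\<in>{\<psi>\<in>per_test P. W1_norm P (s / (s - 1)) \<psi> \<le> 1}. ennreal \<bar>g \<psi>\<bar>)"

text \<open>\<open>L\<^sup>q(0,T;W\<^sup>-\<^sup>1\<^sup>,\<^sup>s)\<close>; as these spaces are separable and reflexive, weak and strong
  measurability in time agree.\<close>

definition Lt_Wneg :: "real \<Rightarrow> real \<Rightarrow> real \<Rightarrow> real \<Rightarrow> (real \<Rightarrow> functional) \<Rightarrow> bool" where
  "Lt_Wneg P T q s g \<longleftrightarrow>
     (\<forall>t\<in>{0<..<T}. linear_functional P (g t)) \<and>
     (\<forall>\<psi>\<in>per_test P. set_borel_measurable borel {0<..<T} (\<lambda>t. g t \<psi>)) \<and>
     Lt_norm q T (Wneg_norm P s) g < top"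

definition Lt_Lp :: "real \<Rightarrow> real \<Rightarrow> real \<Rightarrow> real \<Rightarrow> (real \<Rightarrow> vec3 \<Rightarrow> 'b::real_normed_vector) \<Rightarrow> bool" where
  "Lt_Lp P T q r h \<longleftrightarrow> st_field P h \<and> Lt_norm q T (Lp_norm P r) h < top"

definition pairing :: "real \<Rightarrow> (vec3 \<Rightarrow> vec3) \<Rightarrow> functional" where
  "pairing P v \<psi> = (LINT x:cell P|lborel. v x \<bullet> \<psi> x)"

section \<open>Regularity of weak solutions\<close>

definition C_L2w :: "real \<Rightarrow> real \<Rightarrow> (real \<Rightarrow> vec3 \<Rightarrow> vec3) \<Rightarrow> bool" where
  "C_L2w P T v \<longleftrightarrow>
     (\<exists>C. AE t in lborel. t \<in> {0<..<T} \<longrightarrow> Lp_norm P 2 (v t) \<le> ennreal C) \<and>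
     (\<forall>t\<in>{0..T}. v t \<in> Lp_space P 2) \<and>
     (\<forall>w\<in>Lp_space P 2. continuous_on {0..T} (\<lambda>t. pairing P (v t) w))"

definition C_Lp :: "real \<Rightarrow> real \<Rightarrow> real \<Rightarrow> (real \<Rightarrow> vec3 \<Rightarrow> vec3) \<Rightarrow> bool" where
  "C_Lp P T s v \<longleftrightarrow>
     (\<forall>t\<in>{0..T}. v t \<in> Lp_space P s) \<and>
     (\<forall>t\<^sub>0\<in>{0..T}. ((\<lambda>t. Lp_norm P s (\<lambda>x. v t x - v t\<^sub>0 x)) \<longlongrightarrow> 0) (at t\<^sub>0 within {0..T}))"

text \<open>\<open>\<partial>\<^sub>t v \<in> L\<^sup>2(0,T;H\<^sup>-\<^sup>1) + (L\<^sup>s(0,T;W\<^sup>-\<^sup>1\<^sup>,\<^sup>\<sigma>) \<inter> L\<^sup>q(0,T;L\<^sup>r))\<close>\<close>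

definition dt_regular ::
    "real \<Rightarrow> real \<Rightarrow> real \<Rightarrow> real \<Rightarrow> real \<Rightarrow> real \<Rightarrow> (real \<Rightarrow> vec3 \<Rightarrow> vec3) \<Rightarrow> bool" where
  "dt_regular P T s \<sigma> q r v \<longleftrightarrow>
     (\<exists>g h. Lt_Wneg P T 2 2 g \<and>
        Lt_Wneg P T s \<sigma> (\<lambda>t. pairing P (h t)) \<and> Lt_Lp P T q r h \<and>
        (\<forall>\<theta>\<in>test_on {0<..<T}. \<forall>\<psi>\<in>per_test P.
           - (LINT t:{0<..<T}|lborel. deriv \<theta> t * pairing P (v t) \<psi>)
           = (LINT t:{0<..<T}|lborel. \<theta> t * (g t \<psi> + pairing P (h t) \<psi>))))"

text \<open>\<open>\<pi> \<in> L\<^sup>2((0,T) \<times> \<T>\<^sub>P) + L\<^sup>s(0,T;L\<^sup>\<sigma>)\<close>\<close>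

definition pressure_regular ::
    "real \<Rightarrow> real \<Rightarrow> real \<Rightarrow> real \<Rightarrow> (real \<Rightarrow> vec3 \<Rightarrow> real) \<Rightarrow> bool" where
  "pressure_regular P T s \<sigma> \<pi> \<longleftrightarrow>
     (\<exists>\<pi>\<^sub>1 \<pi>\<^sub>2. Lt_Lp P T 2 2 \<pi>\<^sub>1 \<and> Lt_Lp P T s \<sigma> \<pi>\<^sub>2 \<and>
        (AE z in lborel. fst z \<in> {0<..<T} \<longrightarrow>
           \<pi> (fst z) (snd z) = \<pi>\<^sub>1 (fst z) (snd z) + \<pi>\<^sub>2 (fst z) (snd z)))"

text \<open>\<open>\<nabla>\<pi> \<in> L\<^sup>2(0,T;H\<^sup>-\<^sup>1) + L\<^sup>q(0,T;L\<^sup>r)\<close>\<close>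

definition pressure_gradient_regular ::
    "real \<Rightarrow> real \<Rightarrow> real \<Rightarrow> real \<Rightarrow> (real \<Rightarrow> vec3 \<Rightarrow> real) \<Rightarrow> bool" where
  "pressure_gradient_regular P T q r \<pi> \<longleftrightarrow>
     (\<exists>g h. Lt_Wneg P T 2 2 g \<and> Lt_Lp P T q r h \<and>
        (AE t in lborel. t \<in> {0<..<T} \<longrightarrow> (\<forall>\<psi>\<in>per_test P.
           - (LINT x:cell P|lborel. \<pi> t x * divergence \<psi> x) = g t \<psi> + pairing P (h t) \<psi>)))"

section \<open>The Navier--Stokes equations in the sense of distributions\<close>

definition st_int :: "real \<Rightarrow> (real \<Rightarrow> vec3 \<Rightarrow> real) \<Rightarrow> real" where
  "st_int T g = (LINT z:{0..<T} \<times> UNIV|lborel. g (fst z) (snd z))"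

definition momentum_eq ::
    "real \<Rightarrow> (vec3 \<Rightarrow> vec3) \<Rightarrow> (real \<Rightarrow> vec3 \<Rightarrow> vec3) \<Rightarrow> real
     \<Rightarrow> (real \<Rightarrow> vec3 \<Rightarrow> vec3) \<Rightarrow> (real \<Rightarrow> vec3 \<Rightarrow> real) \<Rightarrow> bool" where
  "momentum_eq T u\<^sub>0 f \<mu> u \<pi> \<longleftrightarrow>
     (\<forall>\<phi>\<in>st_test T. \<forall>j.
        - st_int T (\<lambda>t x. u t x $ j * dt \<phi> (t, x))
        - (LINT x|lborel. u\<^sub>0 x $ j * \<phi> (0, x))
        - st_int T (\<lambda>t x. \<Sum>i\<in>UNIV. u t x $ i * u t x $ j * dx i \<phi> (t, x))
        - st_int T (\<lambda>t x. \<pi> t x * dx j \<phi> (t, x))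
        = \<mu> * st_int T (\<lambda>t x. u t x $ j * laplace_x \<phi> (t, x))
        + st_int T (\<lambda>t x. f t x $ j * \<phi> (t, x)))"

definition incompressible :: "real \<Rightarrow> (real \<Rightarrow> vec3 \<Rightarrow> vec3) \<Rightarrow> bool" where
  "incompressible T u \<longleftrightarrow>
     (\<forall>\<phi>\<in>st_test T. st_int T (\<lambda>t x. \<Sum>i\<in>UNIV. u t x $ i * dx i \<phi> (t, x)) = 0)"

text \<open>The local integrability of the energy flux follows from the regularity of \<open>u\<close> and \<open>\<pi>\<close> by
  Sobolev embedding. It is recorded because the integral of a non-integrable function is \<open>0\<close>.\<close>

definition energy_ineq ::
    "real \<Rightarrow> (vec3 \<Rightarrow> vec3) \<Rightarrow> (real \<Rightarrow> vec3 \<Rightarrow> vec3) \<Rightarrow> real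
     \<Rightarrow> (real \<Rightarrow> vec3 \<Rightarrow> vec3) \<Rightarrow> (real \<Rightarrow> vec3 \<Rightarrow> real^3^3) \<Rightarrow> (real \<Rightarrow> vec3 \<Rightarrow> real) \<Rightarrow> bool" where
  "energy_ineq T u\<^sub>0 f \<mu> u G \<pi> \<longleftrightarrow>
     locally_integrable ({0..<T} \<times> UNIV)
       (\<lambda>z. ((norm (u (fst z) (snd z)))\<^sup>2 / 2 + \<pi> (fst z) (snd z)) *\<^sub>R u (fst z) (snd z)) \<and>
     (\<forall>\<phi>\<in>st_test T. (\<forall>t\<ge>0. \<forall>x. \<phi> (t, x) \<ge> 0) \<longrightarrow>
        - st_int T (\<lambda>t x. (norm (u t x))\<^sup>2 / 2 * dt \<phi> (t, x))
        - (LINT x|lborel. (norm (u\<^sub>0 x))\<^sup>2 / 2 * \<phi> (0, x))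
        - st_int T (\<lambda>t x. \<Sum>i\<in>UNIV. u t x $ i * ((norm (u t x))\<^sup>2 / 2 + \<pi> t x) * dx i \<phi> (t, x))
        + \<mu> * st_int T (\<lambda>t x. (norm (G t x))\<^sup>2 * \<phi> (t, x))
        - \<mu> * st_int T (\<lambda>t x. (norm (u t x))\<^sup>2 / 2 * laplace_x \<phi> (t, x))
        \<le> st_int T (\<lambda>t x. (f t x \<bullet> u t x) * \<phi> (t, x)))"

definition ns_weak_solution ::
    "real \<Rightarrow> (vec3 \<Rightarrow> vec3) \<Rightarrow> (real \<Rightarrow> vec3 \<Rightarrow> vec3) \<Rightarrow> real
     \<Rightarrow> (real \<Rightarrow> vec3 \<Rightarrow> vec3) \<Rightarrow> (real \<Rightarrow> vec3 \<Rightarrow> real) \<Rightarrow> bool" where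
  "ns_weak_solution P u\<^sub>0 f \<mu> u \<pi> \<longleftrightarrow>
     st_field P u \<and> st_field P \<pi> \<and>
     (\<forall>T>0.
        momentum_eq T u\<^sub>0 f \<mu> u \<pi> \<and> incompressible T u \<and>
        C_L2w P T u \<and>
        (\<forall>s\<^sub>1. 1 \<le> s\<^sub>1 \<and> s\<^sub>1 < 2 \<longrightarrow> C_Lp P T s\<^sub>1 u) \<and>
        (\<forall>s\<^sub>2 q. 1 \<le> s\<^sub>2 \<and> 1 \<le> q \<and> q < 2 \<longrightarrow>
           dt_regular P T s\<^sub>2 (3 * s\<^sub>2 / (3 * s\<^sub>2 - 2)) q (3 * q / (2 * (2 * q - 1))) u) \<and>
        (\<forall>s\<^sub>2\<ge>1. pressure_regular P T s\<^sub>2 (3 * s\<^sub>2 / (3 * s\<^sub>2 - 2)) \<pi>) \<and>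
        (\<forall>q. 1 \<le> q \<and> q < 2 \<longrightarrow>
           pressure_gradient_regular P T q (3 * q / (2 * (2 * q - 1))) \<pi>) \<and>
        (\<exists>G. L2_H1_with_gradient P T u G \<and> energy_ineq T u\<^sub>0 f \<mu> u G \<pi>))"

section \<open>The weak Kolmogorov assumption\<close>

text \<open>\<open>u \<mu>\<close> is the velocity field for viscosity \<open>\<mu>\<close>.\<close>

definition K41w :: "real \<Rightarrow> real \<Rightarrow> (real \<Rightarrow> real \<Rightarrow> vec3 \<Rightarrow> vec3) \<Rightarrow> bool" where
  "K41w P \<beta> u \<longleftrightarrow>
     (\<forall>T>0. \<exists>C>0. \<exists>\<kappa>>0. \<forall>\<mu>>0.
        (SUP k\<in>{k\<in>wave_vectors P. norm k \<ge> \<kappa>}.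
           ennreal (norm k powr (3 + \<beta>)) *
           (\<integral>\<^sup>+t\<in>{0<..<T}. ennreal ((norm (fourier P (u \<mu> t) k))\<^sup>2) \<partial>lborel))
        \<le> ennreal C)"

end

theory Submission
  imports Defs
begin

text \<open>Testing the local energy inequality with \<open>\<theta>(t) \<chi>(x)\<close>, where the derivatives of \<open>\<chi>\<close> are differences
  of translates by a period, removes the flux and the viscous diffusion. If moreover
  \<open>- \<theta>' \<ge> c \<theta>\<close> for \<open>t \<ge> 0\<close>, the forcing is absorbed by Young's inequality, which bounds \<open>u\<close> in
  \<open>L\<^sup>2((0,T) \<times> \<T>\<^sub>P)\<close> uniformly in \<open>\<mu>\<close>, hence also every single Fourier mode. Together with
  the Kolmogorov bound for \<open>norm k \<ge> \<kappa>\<close>, the mode \<open>k\<close> has time integral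
  \<open>O((1 + norm k) powr - (3 + \<beta>))\<close>, uniformly in \<open>\<mu>\<close>, and
  \<open>(1 + norm k) powr (2 * \<alpha> - 3 - \<beta>)\<close> is summable over the lattice.\<close>

section \<open>Smooth cutoff functions\<close>

text \<open>The bounds contained in \<open>ns_weak_solution\<close> hold for each solution
  separately, with constants that may depend on \<mu>; the only source of uniformity is the local
  energy inequality. A weight \<chi> on the whole space replaces it: its one-dimensional factor is
  \<eta>(s) = integral of b over [s - P, s], whose translates by multiples of P add up to the
  constant integral of b. So \<chi> acts on periodic functions like the constant 1, and periodic
  quantities integrate to 0 against its derivatives. Viscosity enters the inequality only through
  diffusion, which cancels in this way, and through dissipation, which has a favourable sign. What
  remains depends on the initial data, the force and the test function. The Kolmogorov bound is
  silent about \<open>norm k < \<kappa>\<close>, including k = 0, and there the energy bound steps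
  in. As only time integrals of modes occur, a space-time bound suffices, and the decaying time
  weight yields it without a Gronwall argument. Since non-integrable functions have integral 0, each
  cancellation must be accompanied by a proof of integrability.\<close>

primrec diffs :: "nat \<Rightarrow> (real \<Rightarrow> real) \<Rightarrow> bool" where
  "diffs 0 f \<longleftrightarrow> True"
| "diffs (Suc n) f \<longleftrightarrow> (\<forall>x. f differentiable (at x)) \<and> diffs n (deriv f)"

text \<open>A one-variable counterpart of \<open>smooth\<close> built on \<open>deriv\<close>, which
  suits the product rule and the antiderivatives below. Continuity of each derivative follows from
  its differentiability one level up.\<close>

definition smooth1 :: "(real \<Rightarrow> real) \<Rightarrow> bool" where
  "smooth1 f \<longleftrightarrow> (\<forall>n. diffs n f)"

lemma smooth1_deriv: "smooth1 f \<Longrightarrow> smooth1 (deriv f)"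
  unfolding smooth1_def using diffs.simps(2) by blast

lemma smooth1_differentiable: "smooth1 f \<Longrightarrow> f differentiable (at x)"
  unfolding smooth1_def using diffs.simps(2) by blast

lemma smooth1_DERIV:
  assumes "smooth1 f"
  shows "(f has_real_derivative deriv f x) (at x)"
  using smooth1_differentiable[OF assms] DERIV_imp_deriv real_differentiable_def by blast

lemma diffs_SucI:
  assumes "\<And>x. (f has_real_derivative f' x) (at x)" "diffs n f'"
  shows "diffs (Suc n) f"
proof -
  have "deriv f = f'" using DERIV_imp_deriv[OF assms(1)] by blast
  then show ?thesis using assms real_differentiable_def by auto
qed

lemma smooth1I:
  assumes "\<And>x. (f has_real_derivative f' x) (at x)" "smooth1 f'"
  shows "smooth1 f"
  unfolding smooth1_def
proof
  fix n show "diffs n f"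
    using diffs_SucI[OF assms(1)] assms(2) unfolding smooth1_def by (cases n) auto
qed

lemma diffs_DERIV:
  assumes "diffs (Suc n) f"
  shows "(f has_real_derivative deriv f x) (at x)"
  using assms DERIV_imp_deriv real_differentiable_def by fastforce

lemma diffs_Suc: "diffs (Suc n) f \<Longrightarrow> diffs n f"
  by (induction n arbitrary: f) auto

lemma diffs_add: "diffs n f \<Longrightarrow> diffs n g \<Longrightarrow> diffs n (\<lambda>x. f x + g x)"
proof (induction n arbitrary: f g)
  case (Suc n)
  show ?case
    by (rule diffs_SucI[where f' = "\<lambda>x. deriv f x + deriv g x"])
      (auto intro!: derivative_eq_intros diffs_DERIV[OF Suc.prems(1)] diffs_DERIV[OF Suc.prems(2)]
        Suc.IH simp: Suc.prems[unfolded diffs.simps])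
qed auto

lemma diffs_mult: "diffs n f \<Longrightarrow> diffs n g \<Longrightarrow> diffs n (\<lambda>x. f x * g x)"
proof (induction n arbitrary: f g)
  case (Suc n)
  have "diffs n (deriv f)" "diffs n (deriv g)" "diffs n f" "diffs n g"
    using Suc.prems diffs_Suc by auto
  then show ?case
    by (intro diffs_SucI[where f' = "\<lambda>x. f x * deriv g x + deriv f x * g x"])
      (auto intro!: DERIV_mult' diffs_DERIV[OF Suc.prems(1)] diffs_DERIV[OF Suc.prems(2)]
        diffs_add Suc.IH)
qed auto

lemma smooth1_mult: "smooth1 f \<Longrightarrow> smooth1 g \<Longrightarrow> smooth1 (\<lambda>x. f x * g x)"
  by (simp add: smooth1_def diffs_mult)

lemma smooth1_const: "smooth1 (\<lambda>x. c)"
proof -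
  have "diffs n (\<lambda>x. c)" for n c
    by (induction n arbitrary: c) (auto intro!: diffs_SucI[where f' = "\<lambda>x. 0"] simp del: diffs.simps(2))
  then show ?thesis by (simp add: smooth1_def)
qed

lemma smooth1_add: "smooth1 f \<Longrightarrow> smooth1 g \<Longrightarrow> smooth1 (\<lambda>x. f x + g x)"
  by (simp add: smooth1_def diffs_add)

lemma smooth1_diff: "smooth1 f \<Longrightarrow> smooth1 g \<Longrightarrow> smooth1 (\<lambda>x. f x - g x)"
  using smooth1_add[of f "\<lambda>x. - 1 * g x"] smooth1_mult[OF smooth1_const, of g "- 1"] by simp

lemma diffs_affine: "diffs n f \<Longrightarrow> diffs n (\<lambda>x. f (c * x + d))"
proof (induction n arbitrary: f)
  case (Suc n)
  have "diffs n (\<lambda>x. deriv f (c * x + d))" using Suc by auto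
  moreover have "((\<lambda>x. f (c * x + d)) has_real_derivative c * deriv f (c * x + d)) (at x)" for x
    by (rule DERIV_cong, rule DERIV_chain2[OF diffs_DERIV[OF Suc.prems]])
      (auto intro!: derivative_eq_intros)
  moreover have "diffs n (\<lambda>x. c)" using smooth1_const by (simp add: smooth1_def)
  ultimately show ?case
    by (intro diffs_SucI[where f' = "\<lambda>x. c * deriv f (c * x + d)"] diffs_mult) auto
qed auto

lemma smooth1_affine: "smooth1 f \<Longrightarrow> smooth1 (\<lambda>x. f (c * x + d))"
  by (simp add: smooth1_def diffs_affine)

text \<open>The flat function exp(-1/x), extended by 0 to x <= 0. The polynomial factor p(1/x) makes
  the family closed under differentiation, so that smoothness is an induction over all p at
  once.\<close>

definition expinv :: "real poly \<Rightarrow> real \<Rightarrow> real" where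
  "expinv p x = (if x > 0 then poly p (1 / x) * exp (- (1 / x)) else 0)"

lemma poly_exp_tendsto_0: "((\<lambda>y. poly p y * exp (- y)) \<longlongrightarrow> (0::real)) at_top"
proof -
  have "((\<lambda>y. \<Sum>i\<le>degree p. coeff p i * (y ^ i / exp y)) \<longlongrightarrow> (0::real)) at_top"
    by (intro tendsto_null_sum tendsto_mult_right_zero tendsto_power_div_exp_0)
  moreover have "poly p y * exp (- y) = (\<Sum>i\<le>degree p. coeff p i * (y ^ i / exp y))" for y
    by (simp add: poly_altdef sum_distrib_right exp_minus divide_inverse mult.assoc)
  ultimately show ?thesis by simp
qed

text \<open>For x > 0, differentiating p(1/x) exp(-1/x) produces the factor (1/x)^2 (p - p')(1/x),
  and \<open>[:0, 0, 1:]\<close> is the square of the variable. The same formula holds at 0 because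
  the exponential beats every polynomial.\<close>

lemma expinv_DERIV:
  "(expinv p has_real_derivative expinv ([:0, 0, 1:] * (p - pderiv p)) x) (at x)"
proof -
  consider "x > 0" | "x < 0" | "x = 0" by linarith
  then show ?thesis
  proof cases
    case 1
    have "((\<lambda>x. poly p (1 / x) * exp (- (1 / x))) has_real_derivative
        expinv ([:0, 0, 1:] * (p - pderiv p)) x) (at x)"
      using 1
      by (auto intro!: derivative_eq_intros DERIV_chain2[OF poly_DERIV]
          simp: expinv_def divide_simps power2_eq_square algebra_simps)
    moreover have "eventually (\<lambda>y. poly p (1 / y) * exp (- (1 / y)) = expinv p y) (nhds x)"
      using eventually_nhds_in_open[of "{0<..}" x] 1
      by (auto elim!: eventually_mono simp: expinv_def)
    ultimately show ?thesis
      using DERIV_cong_ev[of x x "\<lambda>x. poly p (1 / x) * exp (- (1 / x))" "expinv p"] by auto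
  next
    case 2
    have "eventually (\<lambda>y. 0 = expinv p y) (nhds x)"
      using eventually_nhds_in_open[of "{..<0}" x] 2
      by (auto elim!: eventually_mono simp: expinv_def)
    then show ?thesis
      using DERIV_cong_ev[of x x "\<lambda>x. 0" "expinv p" 0] 2 by (simp add: expinv_def[of _ x])
  next
    case 3
    \<comment> \<open>The difference quotient at 0, one side at a time. On the right, passing to 1/y
      turns it into y p(y) exp(-y) at infinity.\<close>
    have "((\<lambda>y. expinv p y / y) \<longlongrightarrow> 0) (at_right 0)"
    proof (subst filterlim_at_right_to_top)
      have "eventually (\<lambda>y. poly ([:0, 1:] * p) y * exp (- y) = expinv p (inverse y) / inverse y) at_top"
        using eventually_gt_at_top[of 0]
        by eventually_elim (auto simp: expinv_def field_simps)
      then show "((\<lambda>y. expinv p (inverse y) / inverse y) \<longlongrightarrow> 0) at_top"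
        using poly_exp_tendsto_0[of "[:0, 1:] * p"] by (rule Lim_transform_eventually[rotated])
    qed
    moreover have "((\<lambda>y. expinv p y / y) \<longlongrightarrow> 0) (at_left 0)"
    proof (rule Lim_transform_eventually)
      show "((\<lambda>y. 0) \<longlongrightarrow> 0) (at_left (0::real))" by simp
      show "eventually (\<lambda>y. 0 = expinv p y / y) (at_left 0)"
        by (auto simp: eventually_at_filter expinv_def)
    qed
    ultimately have "((\<lambda>y. expinv p y / y) \<longlongrightarrow> 0) (at 0)"
      by (simp add: filterlim_at_split)
    then show ?thesis using 3 by (simp add: DERIV_def expinv_def)
  qed
qed

lemma smooth1_expinv: "smooth1 (expinv p)"
proof -
  have "diffs n (expinv p)" for n
    by (induction n arbitrary: p)
      (auto intro!: diffs_SucI[OF expinv_DERIV] simp del: diffs.simps(2))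
  then show ?thesis by (simp add: smooth1_def)
qed

definition bump :: "real \<Rightarrow> real \<Rightarrow> real \<Rightarrow> real" where
  "bump a b t = expinv 1 (t - a) * expinv 1 (b - t)"

lemma smooth1_bump: "smooth1 (bump a b)"
  unfolding bump_def
  using smooth1_mult[OF smooth1_affine[OF smooth1_expinv, of 1 1 "- a"]
      smooth1_affine[OF smooth1_expinv, of 1 "-1" b]] by simp

lemma bump_pos: "a < t \<Longrightarrow> t < b \<Longrightarrow> bump a b t > 0"
  by (simp add: bump_def expinv_def)

lemma bump_zero: "t \<le> a \<or> b \<le> t \<Longrightarrow> bump a b t = 0"
  by (auto simp: bump_def expinv_def)

lemma bump_nonneg: "bump a b t \<ge> 0"
  by (simp add: bump_def expinv_def)

text \<open>The bracket is the logarithmic derivative of exp(-1/(t - a) - 1/(b - t)). Outside the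
  open interval and at its endpoints both sides are 0, division by zero included. This explicit form
  makes the decay of the time weight computable.\<close>

lemma deriv_bump:
  "deriv (bump a b) t = bump a b t * (1 / (t - a)\<^sup>2 - 1 / (b - t)\<^sup>2)"
proof -
  have e: "(expinv 1 has_real_derivative expinv 1 x / x\<^sup>2) (at x)" for x
    by (rule DERIV_cong[OF expinv_DERIV]) (simp add: expinv_def power2_eq_square)
  have 1: "((\<lambda>t. expinv 1 (t - a)) has_real_derivative expinv 1 (t - a) / (t - a)\<^sup>2) (at t)"
    by (rule DERIV_cong, rule DERIV_chain2[OF e]) (auto intro!: derivative_eq_intros)
  have 2: "((\<lambda>t. expinv 1 (b - t)) has_real_derivative - (expinv 1 (b - t) / (b - t)\<^sup>2)) (at t)"
    by (rule DERIV_cong, rule DERIV_chain2[OF e]) (auto intro!: derivative_eq_intros)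
  have "(bump a b has_real_derivative bump a b t * (1 / (t - a)\<^sup>2 - 1 / (b - t)\<^sup>2)) (at t)"
    unfolding bump_def
    by (rule DERIV_cong, rule DERIV_mult'[OF 1 2]) (simp add: algebra_simps)
  then show ?thesis by (rule DERIV_imp_deriv)
qed

text \<open>Here \<eta>(s) is the integral of a bump b over the window [s - P, s], so its derivative
  is automatically a difference of two translates of b, and the derivative of \<open>b\<close>
  serves the same purpose for the second derivative of \<eta>.\<close>

lemma exists_cutoff:
  assumes "P > 0"
  obtains \<eta> b where "smooth1 \<eta>" "smooth1 b"
    "\<And>s. deriv \<eta> s = b s - b (s - P)"
    "\<And>s. \<eta> s \<ge> 0" "\<And>s. \<bar>s\<bar> > 2 * P \<Longrightarrow> \<eta> s = 0 \<and> b s = 0"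
    "\<And>s. \<bar>s\<bar> \<le> P / 2 \<Longrightarrow> \<eta> s > 0"
proof -
  \<comment> \<open>The window [s - P, s] lies inside (-2P, P) when s is in [-P/2, P/2], which makes
    \<eta> positive on the cell, and it misses (-2P, P) when s is outside [-2P, 2P].\<close>
  define b where "b = bump (- 2 * P) P"
  have sb: "smooth1 b" by (simp add: b_def smooth1_bump)
  have "\<exists>F. \<forall>x. (- \<infinity>) < ereal x \<longrightarrow> ereal x < \<infinity> \<longrightarrow> (F has_vector_derivative b x) (at x)"
    using smooth1_DERIV[OF sb] by (intro einterval_antiderivative) (auto intro: DERIV_isCont)
  then obtain H where H: "(H has_real_derivative b x) (at x)" for x
    by (auto simp: has_real_derivative_iff_has_vector_derivative)
  define \<eta> where "\<eta> s = H s - H (s - P)" for s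
  have d: "(\<eta> has_real_derivative b s - b (s - P)) (at s)" for s
    unfolding \<eta>_def
    by (rule DERIV_diff[OF H], rule DERIV_cong, rule DERIV_chain2[OF H])
      (auto intro!: derivative_eq_intros)
  have s\<eta>: "smooth1 \<eta>"
    using smooth1I[OF d] smooth1_diff[OF sb smooth1_affine[OF sb, of 1 "- P"]] by simp
  have mono: "H x \<le> H y" if "x \<le> y" for x y
    by (rule DERIV_nonneg_imp_nondecreasing[OF that]) (use H bump_nonneg b_def in blast)
  have const: "H x = H y" if "x \<le> y" "y \<le> - 2 * P \<or> P \<le> x" for x y
  proof -
    have "H y \<le> H x"
    proof (rule DERIV_nonpos_imp_nonincreasing[OF that(1)])
      fix z assume "x \<le> z" "z \<le> y"
      then have "b z = 0" unfolding b_def using that(2) by (intro bump_zero) auto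
      then show "\<exists>y. (H has_real_derivative y) (at z) \<and> y \<le> 0" using H[of z] by auto
    qed
    then show ?thesis using mono[OF that(1)] by simp
  qed
  show thesis
  proof (rule that[OF s\<eta> sb])
    show "deriv \<eta> s = b s - b (s - P)" for s using DERIV_imp_deriv[OF d] .
    show "\<eta> s \<ge> 0" for s using mono[of "s - P" s] assms by (simp add: \<eta>_def)
    show "\<eta> s = 0 \<and> b s = 0" if "\<bar>s\<bar> > 2 * P" for s
      using that assms const[of "s - P" s]
      by (auto simp: \<eta>_def b_def abs_if split: if_splits intro!: bump_zero)
    show "\<eta> s > 0" if "\<bar>s\<bar> \<le> P / 2" for s
    proof -
      have "H (s - P) < H s"
      proof (rule DERIV_pos_imp_increasing[of "s - P" s H])
        fix z assume "s - P \<le> z" "z \<le> s"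
        then have "b z > 0" unfolding b_def using that assms by (intro bump_pos) (auto simp: abs_if split: if_splits)
        then show "\<exists>y. (H has_real_derivative y) (at z) \<and> 0 < y" using H by blast
      qed (use assms in auto)
      then show ?thesis by (simp add: \<eta>_def)
    qed
  qed
qed

section \<open>Product test functions\<close>

text \<open>Separated variables: a partial derivative replaces a single factor by its derivative, so
  the family is closed under differentiation and spatial derivatives inherit the one-dimensional
  difference structure.\<close>

definition tensor :: "(real \<Rightarrow> real) \<Rightarrow> (3 \<Rightarrow> real \<Rightarrow> real) \<Rightarrow> real \<times> vec3 \<Rightarrow> real" where
  "tensor \<theta> g z = \<theta> (fst z) * (\<Prod>j\<in>UNIV. g j (snd z $ j))"

lemma tensor_has_derivative:
  assumes "smooth1 \<theta>" "\<And>j. smooth1 (g j)"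
  shows "(tensor \<theta> g has_derivative
      (\<lambda>v. fst v * tensor (deriv \<theta>) g z
         + (\<Sum>i\<in>UNIV. snd v $ i * tensor \<theta> (g(i := deriv (g i))) z))) (at z)"
proof -
  have 1: "((\<lambda>z. \<theta> (fst z)) has_derivative (\<lambda>v. deriv \<theta> (fst z) * fst v)) (at z)"
    by (rule has_derivative_compose[OF has_derivative_fst[OF has_derivative_ident]
          smooth1_DERIV[OF assms(1), unfolded has_field_derivative_def]])
  have 2: "((\<lambda>z. g j (snd z $ j)) has_derivative (\<lambda>v. deriv (g j) (snd z $ j) * (snd v $ j))) (at z)" for j
  proof (rule has_derivative_compose[OF _ smooth1_DERIV[OF assms(2), unfolded has_field_derivative_def]])
    show "((\<lambda>z. snd z $ j) has_derivative (\<lambda>v. snd v $ j)) (at z)"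
      by (intro bounded_linear_imp_has_derivative bounded_linear_compose[OF bounded_linear_vec_nth bounded_linear_snd])
  qed
  have e: "(\<Prod>j\<in>UNIV. (g(i := deriv (g i))) j (snd z $ j))
      = deriv (g i) (snd z $ i) * (\<Prod>j\<in>UNIV - {i}. g j (snd z $ j))" for i
    by (subst prod.remove[of UNIV i]) (auto intro!: prod.cong)
  show ?thesis
    unfolding tensor_def
    by (rule has_derivative_eq_rhs, rule has_derivative_mult[OF 1 has_derivative_prod[OF 2]])
      (auto simp: e sum_distrib_left algebra_simps simp del: fun_upd_apply)
qed

lemma frechet_derivative_tensor:
  assumes "smooth1 \<theta>" "\<And>j. smooth1 (g j)"
  shows "frechet_derivative (tensor \<theta> g) (at z) v
      = fst v * tensor (deriv \<theta>) g z + (\<Sum>i\<in>UNIV. snd v $ i * tensor \<theta> (g(i := deriv (g i))) z)"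
  by (subst frechet_derivative_at[OF tensor_has_derivative[of \<theta> g, OF assms], symmetric]) simp

section \<open>Smoothness of product functions in the sense of \<open>Ck\<close>\<close>

lemma Ck_scaleR: "Ck n f \<Longrightarrow> Ck n (\<lambda>x. c * f x :: real)"
proof (induction n arbitrary: f)
  case (Suc n)
  have "frechet_derivative (\<lambda>x. c * f x) (at x) = (\<lambda>v. c * frechet_derivative f (at x) v)" for x
    using Suc.prems
    by (intro frechet_derivative_at[symmetric] has_derivative_mult_right)
      (simp add: frechet_derivative_works)
  then show ?case using Suc by (simp add: differentiable_mult)
qed (auto intro!: continuous_intros)

lemma Ck_add: "Ck n f \<Longrightarrow> Ck n g \<Longrightarrow> Ck n (\<lambda>x. f x + g x)"
proof (induction n arbitrary: f g)
  case (Suc n)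
  have "frechet_derivative (\<lambda>x. f x + g x) (at x)
      = (\<lambda>v. frechet_derivative f (at x) v + frechet_derivative g (at x) v)" for x
    using Suc.prems
    by (intro frechet_derivative_at[symmetric] has_derivative_add)
      (simp_all add: frechet_derivative_works)
  then show ?case using Suc by simp
qed (auto intro!: continuous_intros)

lemma Ck_sum:
  fixes f :: "'i \<Rightarrow> 'a::euclidean_space \<Rightarrow> real"
  assumes "finite I" "\<And>i. i \<in> I \<Longrightarrow> Ck n (f i)"
  shows "Ck n (\<lambda>x. \<Sum>i\<in>I. f i x)"
proof -
  have "Ck n (\<lambda>x::'a. 0::real)"
    by (induction n) auto
  with assms show ?thesis
    by (induction I rule: finite_induct) (simp_all add: Ck_add del: Ck.simps)
qed

text \<open>Every directional derivative is a linear combination of functions of the same form, with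
  coefficients depending only on the direction; hence the induction over arbitrary factors.\<close>

lemma Ck_tensor: "smooth1 \<theta> \<Longrightarrow> (\<And>j. smooth1 (g j)) \<Longrightarrow> Ck n (tensor \<theta> g)"
proof (induction n arbitrary: \<theta> g)
  case 0
  then show ?case
    using has_derivative_continuous[OF tensor_has_derivative[of \<theta> g]]
    by (simp add: continuous_at_imp_continuous_on)
next
  case (Suc n)
  have 1: "Ck n (tensor (deriv \<theta>) g)"
    by (intro Suc.IH smooth1_deriv Suc.prems)
  have 2: "Ck n (tensor \<theta> (g(i := deriv (g i))))" for i
    using Suc.prems by (intro Suc.IH) (auto intro: smooth1_deriv)
  show ?case
    unfolding Ck.simps frechet_derivative_tensor[OF Suc.prems]
    using differentiableI[OF tensor_has_derivative[of \<theta> g, OF Suc.prems]]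
    by (intro conjI allI Ck_add[OF Ck_scaleR[OF 1] Ck_sum[OF finite Ck_scaleR[OF 2]]])
qed

lemma smooth_tensor: "smooth1 \<theta> \<Longrightarrow> (\<And>j. smooth1 (g j)) \<Longrightarrow> smooth (tensor \<theta> g)"
  by (simp add: smooth_def Ck_tensor)

lemma continuous_tensor:
  "smooth1 \<theta> \<Longrightarrow> (\<And>j. smooth1 (g j)) \<Longrightarrow> continuous_on S (tensor \<theta> g)"
  using Ck_tensor[of \<theta> g 0] continuous_on_subset[of UNIV "tensor \<theta> g" S] by simp

lemma dt_tensor:
  "smooth1 \<theta> \<Longrightarrow> (\<And>j. smooth1 (g j)) \<Longrightarrow> dt (tensor \<theta> g) = tensor (deriv \<theta>) g"
  by (rule ext) (simp add: dt_def frechet_derivative_tensor[of \<theta> g])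

lemma dx_tensor:
  "smooth1 \<theta> \<Longrightarrow> (\<And>j. smooth1 (g j)) \<Longrightarrow> dx i (tensor \<theta> g) = tensor \<theta> (g(i := deriv (g i)))"
proof
  fix z assume s: "smooth1 \<theta>" "\<And>j. smooth1 (g j)"
  have "axis i 1 $ j * c = (if j = i then c else 0)" for j and c :: real
    by (simp add: axis_def)
  then show "dx i (tensor \<theta> g) z = tensor \<theta> (g(i := deriv (g i))) z"
    by (simp add: dx_def frechet_derivative_tensor[OF s])
qed

lemma tensor_zero:
  assumes "\<And>s. \<bar>s\<bar> > R \<Longrightarrow> g i s = 0" "\<bar>snd z $ i\<bar> > R"
  shows "tensor \<theta> g z = 0"
proof -
  have "(\<Prod>j\<in>UNIV. g j (snd z $ j)) = 0"
    using assms by (intro prod_zero) auto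
  then show ?thesis by (simp add: tensor_def)
qed

lemma tensor_in_st_test:
  assumes "smooth1 \<theta>" "\<And>j. smooth1 (g j)"
    and "\<And>t. t \<notin> {a..b} \<Longrightarrow> \<theta> t = 0" "b < T"
    and "\<And>j s. \<bar>s\<bar> > R \<Longrightarrow> g j s = 0"
  shows "tensor \<theta> g \<in> st_test T"
proof -
  let ?K = "{a..b} \<times> cbox (\<chi> i::3. - R) (\<chi> i. R)"
  have "tensor \<theta> g z = 0" if "z \<notin> ?K" for z
  proof (cases "fst z \<in> {a..b}")
    case True
    then have "\<not> (\<forall>j. - R \<le> snd z $ j \<and> snd z $ j \<le> R)"
      using that by (simp add: mem_Times_iff mem_box_cart)
    then obtain j where "\<not> (- R \<le> snd z $ j \<and> snd z $ j \<le> R)" by blast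
    then have "\<bar>snd z $ j\<bar> > R" by linarith
    then show ?thesis using tensor_zero[of R g j z] assms(5) by blast
  qed (simp add: tensor_def assms(3))
  moreover have "compact ?K"
    by (intro compact_Times compact_Icc compact_cbox)
  moreover have "?K \<subseteq> {..<T} \<times> UNIV"
    using assms(4) by auto
  ultimately show ?thesis
    using smooth_tensor[of \<theta> g, OF assms(1,2)]
    unfolding test_on_def by (intro CollectI conjI exI[of _ ?K]) simp_all
qed

text \<open>Translation by P in direction i changes only the i-th factor, so a difference of
  translates in that factor is a difference of translates of the whole function.\<close>

lemma tensor_shift_diff:
  assumes "\<And>s. h s = b s - b (s - P)"
  shows "tensor \<theta> (g(i := h)) (t, x)
    = tensor \<theta> (g(i := b)) (t, x) - tensor \<theta> (g(i := b)) (t, x - P *\<^sub>R axis i 1)"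
proof -
  have *: "(\<Prod>j\<in>UNIV. (g(i := c)) j (y $ j)) = c (y $ i) * (\<Prod>j\<in>UNIV - {i}. g j (y $ j))"
    for c and y :: vec3
    by (subst prod.remove[of UNIV i]) (auto intro!: prod.cong)
  have **: "(\<Prod>j\<in>UNIV - {i}. g j ((x - P *\<^sub>R axis i 1) $ j)) = (\<Prod>j\<in>UNIV - {i}. g j (x $ j))"
    by (intro prod.cong) (auto simp: axis_def)
  show ?thesis
    unfolding tensor_def fst_conv snd_conv * ** by (simp add: assms axis_def algebra_simps)
qed

section \<open>Integrals of periodic functions\<close>

lemma lborel_distr_translation:
  fixes a :: "'a::euclidean_space"
  shows "distr lborel borel (\<lambda>x. x + a) = lborel"
  using lborel_affine[of 1 a] by (simp add: density_1 add.commute)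

lemma nn_integral_translation:
  fixes f :: "'a::euclidean_space \<Rightarrow> ennreal"
  assumes [measurable]: "f \<in> borel_measurable borel"
  shows "(\<integral>\<^sup>+x. f (x + a) \<partial>lborel) = (\<integral>\<^sup>+x. f x \<partial>lborel)"
  by (subst (2) lborel_distr_translation[of a, symmetric], subst nn_integral_distr) auto

text \<open>Translation invariance of Lebesgue measure. The form \<open>has_bochner_integral\<close>
  carries integrability along, which is what allows the sum over the three directions later.\<close>

lemma has_bochner_integral_translation_diff:
  fixes F :: "'a::euclidean_space \<Rightarrow> real"
  assumes "integrable lborel F"
  shows "has_bochner_integral lborel (\<lambda>z. F z - F (z - a)) 0"
proof -
  have m: "F \<in> borel_measurable borel" using assms by auto
  have "integrable (distr lborel borel (\<lambda>x. x + - a)) F"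
    using assms by (subst lborel_distr_translation)
  then have i: "integrable lborel (\<lambda>z. F (z - a))"
    using integrable_distr_eq[of "\<lambda>x. x + - a" lborel borel F] m by simp
  have "(\<integral>z. F z \<partial>distr lborel borel (\<lambda>x. x + - a)) = (\<integral>z. F (z - a) \<partial>lborel)"
    using integral_distr[of "\<lambda>x. x + - a" lborel borel F] m by simp
  then have "(\<integral>z. F (z - a) \<partial>lborel) = (\<integral>z. F z \<partial>lborel)"
    by (subst (asm) lborel_distr_translation) simp
  then show ?thesis
    using has_bochner_integral_diff[OF has_bochner_integral_integrable[OF assms]
        has_bochner_integral_integrable[OF i]] by simp
qed

section \<open>Lattice translations and the comparison of a large box with the cell\<close>

lemma periodic_int:
  assumes "periodic P v"
  shows "v (x + (P * of_int n) *\<^sub>R axis i 1) = v x"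
proof -
  have nat: "v (x + (P * of_nat n) *\<^sub>R axis i 1) = v x" for n x
  proof (induction n)
    case (Suc n)
    have "x + (P * of_nat (Suc n)) *\<^sub>R axis i 1 = (x + (P * of_nat n) *\<^sub>R axis i 1) + P *\<^sub>R axis i 1"
      by (simp add: algebra_simps)
    then show ?case using assms Suc by (simp only: periodic_def)
  qed simp
  show ?thesis
  proof (cases n rule: int_cases2)
    case (nonneg k) then show ?thesis using nat by simp
  next
    case (nonpos k)
    then show ?thesis using nat[of "x + (P * of_int n) *\<^sub>R axis i 1" k] by (simp add: algebra_simps)
  qed
qed

lemma periodic_lattice:
  fixes m :: "int^3"
  assumes "periodic P v"
  shows "v (x + P *\<^sub>R (\<chi> i. of_int (m $ i))) = v x"
proof -
  have "P *\<^sub>R (\<chi> i. of_int (m $ i)) = (P * of_int (m $ 1)) *\<^sub>R axis 1 1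
      + (P * of_int (m $ 2)) *\<^sub>R axis 2 1 + (P * of_int (m $ 3)) *\<^sub>R (axis 3 1 :: vec3)"
    by (simp add: vec_eq_iff forall_3 axis_def)
  then show ?thesis
    by (simp only: add.assoc[symmetric] periodic_int[OF assms])
qed

lemma finite_int_vec3: "finite {m::int^3. \<forall>i. \<bar>m $ i\<bar> \<le> N}"
proof (rule finite_subset)
  show "{m::int^3. \<forall>i. \<bar>m $ i\<bar> \<le> N}
      \<subseteq> (\<lambda>(a, b, c). vector [a, b, c]) ` ({- N..N} \<times> {- N..N} \<times> {- N..N})"
  proof
    fix m :: "int^3" assume "m \<in> {m. \<forall>i. \<bar>m $ i\<bar> \<le> N}"
    then have "(m $ 1, m $ 2, m $ 3) \<in> {- N..N} \<times> {- N..N} \<times> {- N..N}"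
      by (auto simp: forall_3)
    moreover have "m = vector [m $ 1, m $ 2, m $ 3]"
      by (simp add: vec_eq_iff forall_3)
    ultimately show "m \<in> (\<lambda>(a, b, c). vector [a, b, c]) ` ({- N..N} \<times> {- N..N} \<times> {- N..N})"
      by (intro image_eqI[of _ _ "(m $ 1, m $ 2, m $ 3)"]) auto
  qed
qed auto

text \<open>Contains the spatial support of every test function and weight in the energy
  estimate.\<close>

definition box2 :: "real \<Rightarrow> vec3 set" where
  "box2 P = cbox (\<chi> i. - (2 * P)) (\<chi> i. 2 * P)"

lemma mem_box2: "x \<in> box2 P \<longleftrightarrow> (\<forall>i. \<bar>x $ i\<bar> \<le> 2 * P)"
  by (auto simp: box2_def mem_box_cart abs_le_iff minus_le_iff)

lemma mem_cell: "x \<in> cell P \<longleftrightarrow> (\<forall>i. \<bar>x $ i\<bar> \<le> P / 2)"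
proof -
  have "(- P / 2 \<le> y \<and> y \<le> P / 2) = (\<bar>y\<bar> \<le> P / 2)" for y :: real by linarith
  then show ?thesis by (simp add: cell_def mem_box_cart)
qed

lemma cell_measurable [measurable]: "cell P \<in> sets borel"
  by (simp add: cell_def)

lemma box2_measurable [measurable]: "box2 P \<in> sets borel"
  by (simp add: box2_def)

text \<open>Finitely many lattice translates of the cell cover the box, and a periodic function has
  the same integral over each of them. The factor is chosen before \<open>h\<close>, so one factor
  serves all times at once.\<close>

lemma periodic_nn_integral_box2:
  "\<exists>N::real. \<forall>h\<in>borel_measurable borel. periodic P h \<longrightarrow>
    (\<integral>\<^sup>+x. h x * indicator (box2 P) x \<partial>lborel) \<le> ennreal N * (\<integral>\<^sup>+x. h x * indicator (cell P) x \<partial>lborel)"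
proof (intro exI ballI impI)
  define M :: "(int^3) set" where "M = {m. \<forall>i. \<bar>m $ i\<bar> \<le> 2}"
  have fin: "finite M" unfolding M_def by (rule finite_int_vec3)
  let ?v = "\<lambda>m::int^3. P *\<^sub>R (\<chi> i. of_int (m $ i)) :: vec3"
  fix h :: "vec3 \<Rightarrow> ennreal" assume [measurable]: "h \<in> borel_measurable borel" and per: "periodic P h"
  have cover: "indicator (box2 P) x \<le> (\<Sum>m\<in>M. indicator (cell P) (x + ?v m) :: ennreal)" for x
  proof (cases "x \<in> box2 P")
    case True
    \<comment> \<open>Rounding \<open>x $ i / P\<close> gives the lattice vector that moves
      \<open>x\<close> into the cell; since the quotients lie in [-2, 2], so do their
      roundings.\<close>
    define m :: "int^3" where "m = (\<chi> i. - round (x $ i / P))"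
    have b: "\<bar>x $ i\<bar> \<le> 2 * P" for i using True by (simp add: mem_box2)
    have P: "P \<ge> 0" using b[of 1] by linarith
    have "\<bar>m $ i\<bar> \<le> 2 \<and> \<bar>x $ i + P * of_int (m $ i)\<bar> \<le> P / 2" for i
    proof (cases "P = 0")
      case True then show ?thesis using b[of i] by (simp add: m_def)
    next
      case False
      with P have "P > 0" by simp
      have "\<bar>x $ i / P\<bar> \<le> 2" using b[of i] \<open>P > 0\<close> by (simp add: abs_divide field_simps)
      then have "-2 \<le> x $ i / P" "x $ i / P \<le> 2" by linarith+
      then have "round (-2 :: real) \<le> round (x $ i / P)" "round (x $ i / P) \<le> round (2::real)"
        by (blast intro: round_mono)+
      then have 1: "\<bar>m $ i\<bar> \<le> 2" by (simp add: m_def)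
      have "\<bar>of_int (round (x $ i / P)) - x $ i / P\<bar> \<le> 1 / 2" by (rule of_int_round_abs_le)
      then have "P * \<bar>of_int (round (x $ i / P)) - x $ i / P\<bar> \<le> P * (1 / 2)"
        using \<open>P > 0\<close> by (intro mult_left_mono) auto
      also have "P * \<bar>of_int (round (x $ i / P)) - x $ i / P\<bar> = \<bar>x $ i + P * of_int (m $ i)\<bar>"
      proof -
        have "P * (of_int (round (x $ i / P)) - x $ i / P) = - (x $ i + P * of_int (m $ i))"
          using \<open>P > 0\<close> by (simp add: m_def field_simps)
        then have "\<bar>P * (of_int (round (x $ i / P)) - x $ i / P)\<bar> = \<bar>x $ i + P * of_int (m $ i)\<bar>"
          by simp
        then show ?thesis using \<open>P > 0\<close> by (simp add: abs_mult)
      qed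
      finally show ?thesis using 1 by simp
    qed
    then have "m \<in> M" "x + ?v m \<in> cell P" by (auto simp: M_def mem_cell)
    then have "(\<Sum>m\<in>M. indicator (cell P) (x + ?v m) :: ennreal) \<ge> indicator (cell P) (x + ?v m)"
      using fin by (intro member_le_sum) auto
    then show ?thesis using True \<open>x + ?v m \<in> cell P\<close> by simp
  qed simp
  have "(\<integral>\<^sup>+x. h x * indicator (box2 P) x \<partial>lborel)
      \<le> (\<integral>\<^sup>+x. (\<Sum>m\<in>M. h x * indicator (cell P) (x + ?v m)) \<partial>lborel)"
    unfolding sum_distrib_left[symmetric] by (intro nn_integral_mono mult_left_mono cover) simp
  also have "\<dots> = (\<Sum>m\<in>M. \<integral>\<^sup>+x. h (x + ?v m) * indicator (cell P) (x + ?v m) \<partial>lborel)"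
    by (subst nn_integral_sum) (auto simp: periodic_lattice[OF per])
  also have "\<dots> = (\<Sum>m\<in>M. \<integral>\<^sup>+x. h x * indicator (cell P) x \<partial>lborel)"
    by (intro sum.cong refl nn_integral_translation[of "\<lambda>x. h x * indicator (cell P) x"]) measurable
  finally show "(\<integral>\<^sup>+x. h x * indicator (box2 P) x \<partial>lborel)
      \<le> ennreal (real (card M)) * (\<integral>\<^sup>+x. h x * indicator (cell P) x \<partial>lborel)"
    by (simp add: ennreal_of_nat_eq_real_of_nat)
qed

section \<open>Norms as integrals\<close>

lemma epow_inverse:
  assumes "a > 0"
  shows "epow (epow x (1 / a)) a = x"
  using assms by (cases x) (auto simp: epow_def powr_powr)

lemma epow_less_top_iff: "epow x a < top \<longleftrightarrow> x < top"
  by (auto simp: epow_def less_top)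

lemma epow_Lp_norm_2:
  "epow (Lp_norm P 2 v) 2 = (\<integral>\<^sup>+x\<in>cell P. ennreal ((norm (v x))\<^sup>2) \<partial>lborel)"
  unfolding Lp_norm_def by (subst epow_inverse) simp_all

text \<open>The squared L2 norm over the cell as an integral in [0, \<infinity>], so that the roots
  introduced by \<open>epow\<close> disappear.\<close>

definition energy :: "real \<Rightarrow> (vec3 \<Rightarrow> 'b::real_normed_vector) \<Rightarrow> ennreal" where
  "energy P v = (\<integral>\<^sup>+x\<in>cell P. ennreal ((norm (v x))\<^sup>2) \<partial>lborel)"

lemma Lt_norm_2_Lp_norm_2:
  "Lt_norm 2 T (Lp_norm P 2) v < top \<longleftrightarrow> (\<integral>\<^sup>+t\<in>{0<..<T}. energy P (v t) \<partial>lborel) < top"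
  by (simp add: Lt_norm_def epow_less_top_iff epow_Lp_norm_2 energy_def)

section \<open>Integrability on space-time\<close>

lemma slab_measurable [measurable]: "{0..<T::real} \<times> (UNIV :: vec3 set) \<in> sets borel"
  by (intro borel_Times) auto

text \<open>A field is controlled only for nonnegative times, so every measurability argument goes
  through its extension by 0 from a slab.\<close>

lemma st_field_slab_measurable:
  fixes v :: "real \<Rightarrow> vec3 \<Rightarrow> 'b::euclidean_space"
  assumes "st_field P v" "S \<in> sets borel" "S \<subseteq> {0..} \<times> UNIV"
  shows "(\<lambda>z. indicator S z *\<^sub>R v (fst z) (snd z)) \<in> borel_measurable borel"
proof -
  have [measurable]: "(\<lambda>z. indicator ({0..} \<times> UNIV) z *\<^sub>R v (fst z) (snd z)) \<in> borel_measurable borel"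
    using assms(1) by (simp add: st_field_def set_borel_measurable_def)
  have [measurable]: "S \<in> sets borel" by fact
  have "(\<lambda>z. indicator S z *\<^sub>R v (fst z) (snd z))
      = (\<lambda>z. indicator S z *\<^sub>R (indicator ({0..} \<times> UNIV) z *\<^sub>R v (fst z) (snd z)))"
    using assms(3) by (auto simp: fun_eq_iff split: split_indicator)
  then show ?thesis by (simp only:) measurable
qed

text \<open>The form required for integrating out x against \<open>lborel\<close> with t as a
  parameter: the product algebra agrees with the Borel sets of the product space.\<close>

lemma st_field_slab_measurable_pair:
  fixes v :: "real \<Rightarrow> vec3 \<Rightarrow> 'b::euclidean_space"
  assumes "st_field P v"
  shows "(\<lambda>z. indicator ({0<..<T} \<times> UNIV) z *\<^sub>R v (fst z) (snd z)) \<in> borel_measurable (borel \<Otimes>\<^sub>M lborel)"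
proof -
  have "(\<lambda>z. indicator ({0<..<T} \<times> UNIV) z *\<^sub>R v (fst z) (snd z)) \<in> borel_measurable borel"
    by (intro st_field_slab_measurable[OF assms] borel_Times) auto
  moreover have "sets (borel \<Otimes>\<^sub>M lborel) = sets (borel :: (real \<times> vec3) measure)"
    unfolding borel_prod[symmetric] by (intro sets_pair_measure_cong) auto
  ultimately show ?thesis
    by (simp add: measurable_def sets_eq_imp_space_eq[of "borel \<Otimes>\<^sub>M lborel" "borel"])
qed

lemma st_field_section:
  fixes v :: "real \<Rightarrow> vec3 \<Rightarrow> 'b::euclidean_space"
  assumes "st_field P v" "t \<ge> 0"
  shows "v t \<in> borel_measurable borel"
proof -
  have "(\<lambda>z. indicator ({0..} \<times> UNIV) z *\<^sub>R v (fst z) (snd z)) \<in> borel_measurable (borel \<Otimes>\<^sub>M borel)"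
    using assms(1) by (simp add: st_field_def set_borel_measurable_def borel_prod)
  from measurable_compose[OF measurable_Pair1'[of t borel borel] this] show ?thesis
    using assms(2) by (simp add: space_borel)
qed

lemma nn_integral_lborel_prod:
  fixes h :: "real \<times> vec3 \<Rightarrow> ennreal"
  assumes "h \<in> borel_measurable borel"
  shows "(\<integral>\<^sup>+z. h z \<partial>lborel) = (\<integral>\<^sup>+t. \<integral>\<^sup>+x. h (t, x) \<partial>lborel \<partial>lborel)"
proof -
  have "h \<in> borel_measurable (lborel \<Otimes>\<^sub>M lborel)"
    using assms by (simp add: lborel_prod)
  then show ?thesis
    by (subst lborel.nn_integral_fst) (simp_all add: lborel_prod)
qed

lemma energy_measurable:
  fixes v :: "real \<Rightarrow> vec3 \<Rightarrow> 'b::euclidean_space"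
  assumes "st_field P v"
  shows "(\<lambda>t. energy P (v t) * indicator {0<..<T} t) \<in> borel_measurable borel"
proof -
  define V where "V z = indicator ({0<..<T} \<times> UNIV) z *\<^sub>R v (fst z) (snd z)" for z
  have [measurable]: "V \<in> borel_measurable (borel \<Otimes>\<^sub>M lborel)"
    unfolding V_def using st_field_slab_measurable_pair[OF assms] .
  have "(\<lambda>t. \<integral>\<^sup>+x. ennreal ((norm (V (t, x)))\<^sup>2) * indicator (cell P) x \<partial>lborel) \<in> borel_measurable borel"
    by measurable
  moreover have "(\<integral>\<^sup>+x. ennreal ((norm (V (t, x)))\<^sup>2) * indicator (cell P) x \<partial>lborel)
      = energy P (v t) * indicator {0<..<T} t" for t
    by (simp add: V_def energy_def indicator_times split: split_indicator)
  ultimately show ?thesis by simp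
qed

text \<open>By Tonelli, the integral over the slab is bounded by \<open>B\<close> times the time
  integral of the energy over \<open>box2 P\<close>, which is a multiple of the energy over one cell
  by periodicity.\<close>

lemma st_sq_integrable:
  fixes v :: "real \<Rightarrow> vec3 \<Rightarrow> 'b::euclidean_space"
  assumes v: "st_field P v" and fin: "(\<integral>\<^sup>+t\<in>{0<..<T}. energy P (v t) \<partial>lborel) < top"
    and [measurable]: "w \<in> borel_measurable borel"
    and B: "\<And>z. \<bar>w z\<bar> \<le> B" and supp: "\<And>z. snd z \<notin> box2 P \<Longrightarrow> w z = 0"
  shows "integrable lborel
    (\<lambda>z. indicator ({0..<T} \<times> UNIV) z * ((norm (v (fst z) (snd z)))\<^sup>2 * w z) :: real)"
proof -
  let ?A = "{0..<T} \<times> (UNIV :: vec3 set)"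
  define V where "V z = indicator ?A z *\<^sub>R v (fst z) (snd z)" for z
  have V[measurable]: "V \<in> borel_measurable borel"
    unfolding V_def by (intro st_field_slab_measurable[OF v]) auto
  have eq: "indicator ?A z * ((norm (v (fst z) (snd z)))\<^sup>2 * w z) = (norm (V z))\<^sup>2 * w z" for z
    by (auto simp: V_def split: split_indicator)
  have B0: "B \<ge> 0" using B[of undefined] by linarith
  obtain N :: real where N: "\<And>h. h \<in> borel_measurable borel \<Longrightarrow> periodic P h \<Longrightarrow>
    (\<integral>\<^sup>+x. h x * indicator (box2 P) x \<partial>lborel) \<le> ennreal N * (\<integral>\<^sup>+x. h x * indicator (cell P) x \<partial>lborel)"
    using periodic_nn_integral_box2[of P] by blast
  have snd_box[measurable]: "(\<lambda>z::real \<times> vec3. indicator (box2 P) (snd z) :: ennreal) \<in> borel_measurable borel"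
    unfolding borel_prod[symmetric] by measurable
  \<comment> \<open>The slab contains the slice t = 0, about which \<open>fin\<close> says nothing.
    That slice is null and is left out here.\<close>
  have inner: "(\<integral>\<^sup>+x. ennreal ((norm (V (t, x)))\<^sup>2) * indicator (box2 P) x \<partial>lborel)
      \<le> ennreal N * (energy P (v t) * indicator {0<..<T} t)" if "t \<noteq> 0" for t
  proof (cases "t \<in> {0<..<T}")
    case True
    then have "(\<integral>\<^sup>+x. ennreal ((norm (V (t, x)))\<^sup>2) * indicator (box2 P) x \<partial>lborel)
        = (\<integral>\<^sup>+x. ennreal ((norm (v t x))\<^sup>2) * indicator (box2 P) x \<partial>lborel)"
      by (intro nn_integral_cong) (simp add: V_def)
    also have "\<dots> \<le> ennreal N * (\<integral>\<^sup>+x. ennreal ((norm (v t x))\<^sup>2) * indicator (cell P) x \<partial>lborel)"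
    proof (rule N)
      have [measurable]: "v t \<in> borel_measurable borel"
        using True by (intro st_field_section[OF v]) auto
      show "(\<lambda>x. ennreal ((norm (v t x))\<^sup>2)) \<in> borel_measurable borel" by measurable
      show "periodic P (\<lambda>x. ennreal ((norm (v t x))\<^sup>2))"
        using v True by (auto simp: st_field_def periodic_def)
    qed
    finally show ?thesis using True by (simp add: energy_def)
  next
    case False
    with that have "V (t, x) = 0" for x by (auto simp: V_def)
    then show ?thesis by simp
  qed
  have "(\<integral>\<^sup>+z. ennreal (norm ((norm (V z))\<^sup>2 * w z)) \<partial>lborel)
      \<le> (\<integral>\<^sup>+z. ennreal B * (ennreal ((norm (V z))\<^sup>2) * indicator (box2 P) (snd z)) \<partial>lborel)"
  proof (intro nn_integral_mono)
    fix z show "ennreal (norm ((norm (V z))\<^sup>2 * w z))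
        \<le> ennreal B * (ennreal ((norm (V z))\<^sup>2) * indicator (box2 P) (snd z))"
      using B[of z] B0 supp[of z]
      by (cases "snd z \<in> box2 P")
        (simp_all add: ennreal_mult[symmetric] abs_mult mult.commute[of B] ennreal_leI mult_left_mono)
  qed
  also have "\<dots> = ennreal B * (\<integral>\<^sup>+z. ennreal ((norm (V z))\<^sup>2) * indicator (box2 P) (snd z) \<partial>lborel)"
    by (intro nn_integral_cmult) measurable
  also have "(\<integral>\<^sup>+z. ennreal ((norm (V z))\<^sup>2) * indicator (box2 P) (snd z) \<partial>lborel)
      = (\<integral>\<^sup>+t. \<integral>\<^sup>+x. ennreal ((norm (V (t, x)))\<^sup>2) * indicator (box2 P) x \<partial>lborel \<partial>lborel)"
    using nn_integral_lborel_prod[of "\<lambda>z. ennreal ((norm (V z))\<^sup>2) * indicator (box2 P) (snd z)"] by simp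
  also have "\<dots> \<le> (\<integral>\<^sup>+t. ennreal N * (energy P (v t) * indicator {0<..<T} t) \<partial>lborel)"
  proof (intro nn_integral_mono_AE)
    show "AE t in lborel. (\<integral>\<^sup>+x. ennreal ((norm (V (t, x)))\<^sup>2) * indicator (box2 P) x \<partial>lborel)
        \<le> ennreal N * (energy P (v t) * indicator {0<..<T} t)"
      using AE_lborel_singleton[of 0] by eventually_elim (rule inner)
  qed
  also have "\<dots> = ennreal N * (\<integral>\<^sup>+t\<in>{0<..<T}. energy P (v t) \<partial>lborel)"
    using energy_measurable[OF v] by (intro nn_integral_cmult) simp
  also have "ennreal B * \<dots> < \<infinity>"
    using fin by (auto simp: ennreal_mult_less_top)
  finally have "(\<integral>\<^sup>+z. ennreal (norm ((norm (V z))\<^sup>2 * w z)) \<partial>lborel) < \<infinity>"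
    by (simp add: mult_left_mono)
  then show ?thesis
    unfolding eq by (intro integrableI_bounded) measurable
qed

section \<open>The energy estimate\<close>

lemma deriv_zero_outside:
  assumes "\<And>s. \<bar>s\<bar> > R \<Longrightarrow> f s = 0" "\<bar>s\<bar> > R"
  shows "deriv f s = (0::real)"
proof -
  have "open {s::real. R < \<bar>s\<bar>}" by (intro open_Collect_less continuous_intros)
  then have "eventually (\<lambda>s. s \<in> {s. R < \<bar>s\<bar>}) (nhds s)"
    using assms(2) by (intro eventually_nhds_in_open) auto
  then have "eventually (\<lambda>s. f s = 0) (nhds s)"
    by eventually_elim (auto simp: assms(1))
  then have "deriv f s = deriv (\<lambda>s. 0) s" by (rule deriv_cong_ev) simp
  then show ?thesis by simp
qed

lemma tensor_bounded:
  assumes "smooth1 \<theta>" "\<And>j. smooth1 (g j)" "\<And>t. t \<notin> {a..b} \<Longrightarrow> \<theta> t = 0"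
    and "\<And>j s. \<bar>s\<bar> > R \<Longrightarrow> g j s = 0"
  shows "\<exists>B. \<forall>z. \<bar>tensor \<theta> g z\<bar> \<le> B"
proof -
  from tensor_in_st_test[of \<theta> g a b "b + 1" R, OF assms(1-3) _ assms(4)]
  obtain K where K: "compact K" "\<And>z. z \<notin> K \<Longrightarrow> tensor \<theta> g z = 0"
    unfolding test_on_def by auto
  have "bounded (tensor \<theta> g ` K)"
    using K(1) continuous_tensor[of \<theta> g K] assms(1,2)
    by (intro compact_imp_bounded compact_continuous_image) auto
  then obtain B where "B > 0" "\<And>z. z \<in> K \<Longrightarrow> \<bar>tensor \<theta> g z\<bar> \<le> B"
    by (auto simp: bounded_pos)
  then show ?thesis using K(2) by (metis abs_zero less_imp_le)
qed

lemma tensor_zero_outside_box2: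
  assumes "\<And>j s. \<bar>s\<bar> > 2 * P \<Longrightarrow> g j s = 0" "snd z \<notin> box2 P"
  shows "tensor \<theta> g z = 0"
proof -
  obtain j where "\<bar>snd z $ j\<bar> > 2 * P" using assms(2) by (auto simp: mem_box2 not_le)
  then show ?thesis using tensor_zero[of "2 * P" g j z] assms(1) by blast
qed

lemma tensor_measurable:
  "smooth1 \<theta> \<Longrightarrow> (\<And>j. smooth1 (g j)) \<Longrightarrow> tensor \<theta> g \<in> borel_measurable borel"
  by (intro borel_measurable_continuous_onI continuous_tensor)

text \<open>The cancellation behind the energy estimate. As q is periodic, q times the weight with
  factor \<open>h\<close> is F minus its translate by P in direction i, where F carries the factor
  \<open>b\<close>. The shift is purely spatial, so the time slab is preserved. Integrability is
  asked of F, not merely of the difference.\<close>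

lemma periodic_integral_shift_diff:
  assumes per: "\<And>t. t \<ge> 0 \<Longrightarrow> periodic P (q t)"
    and int: "integrable lborel (\<lambda>z. indicator ({0..<T} \<times> UNIV) z * (q (fst z) (snd z) * tensor \<theta> (g(i := b)) z))"
    and h: "\<And>s. h s = b s - b (s - P)"
  shows "has_bochner_integral lborel
    (\<lambda>z. indicator ({0..<T} \<times> UNIV) z * (q (fst z) (snd z) * tensor \<theta> (g(i := h)) z)) (0::real)"
proof -
  let ?F = "\<lambda>z. indicator ({0..<T} \<times> UNIV) z * (q (fst z) (snd z) * tensor \<theta> (g(i := b)) z) :: real"
  have "?F z - ?F (z - (0, P *\<^sub>R axis i 1))
      = indicator ({0..<T} \<times> UNIV) z * (q (fst z) (snd z) * tensor \<theta> (g(i := h)) z)" for z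
  proof (cases z)
    case (Pair t x)
    have "q t (x - P *\<^sub>R axis i 1) = q t x" if "t \<ge> 0"
      using per[OF that] unfolding periodic_def by (metis diff_add_cancel)
    then show ?thesis
      unfolding Pair tensor_shift_diff[of h b P \<theta> g i t x, OF h]
      by (auto simp: algebra_simps simp del: fun_upd_apply split: split_indicator)
  qed
  then show ?thesis
    using has_bochner_integral_translation_diff[OF int, of "(0, P *\<^sub>R axis i 1)"] by simp
qed

text \<open>Expands the square of \<open>a - (c / 2) *\<^sub>R b\<close>. The coefficient c / 4 is
  half of the c / 2 that the decay of the time weight provides, so part of the good term
  survives.\<close>

lemma young_weighted:
  fixes a b :: "'a::real_inner"
  assumes "c > 0"
  shows "a \<bullet> b \<le> (norm a)\<^sup>2 / c + c / 4 * (norm b)\<^sup>2"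
proof -
  have "0 \<le> (norm (a - (c / 2) *\<^sub>R b))\<^sup>2" by simp
  also have "\<dots> = (norm a)\<^sup>2 - c * (a \<bullet> b) + c\<^sup>2 / 4 * (norm b)\<^sup>2"
    unfolding power2_norm_eq_inner
    by (simp add: inner_diff_left inner_diff_right inner_commute[of b a] power2_eq_square field_simps)
  also have "\<dots> = c * ((norm a)\<^sup>2 / c + c / 4 * (norm b)\<^sup>2 - a \<bullet> b)"
    using assms by (simp add: right_diff_distrib distrib_left power2_eq_square)
  finally show ?thesis using assms by (simp add: zero_le_mult_iff)
qed

text \<open>The bound \<open>M\<close> is chosen before \<mu> and the solution. It is built from the
  initial data, the force and one fixed test function, which are the only ingredients left in the
  energy inequality after the cancellations.\<close>

lemma energy_bound_uniform:
  fixes f :: "real \<Rightarrow> vec3 \<Rightarrow> vec3"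
  assumes "P > 0" "T > 0" and force: "\<And>T. T > 0 \<Longrightarrow> Lt_Lp P T 2 2 f"
  shows "\<exists>M. \<forall>\<mu> u \<pi>. \<mu> > 0 \<longrightarrow> ns_weak_solution P u\<^sub>0 f \<mu> u \<pi> \<longrightarrow>
    (\<integral>\<^sup>+t\<in>{0<..<T}. energy P (u t) \<partial>lborel) \<le> ennreal M"
proof -
  obtain \<eta> b where \<eta>: "smooth1 \<eta>" "smooth1 b" "\<And>s. deriv \<eta> s = b s - b (s - P)"
    "\<And>s. \<eta> s \<ge> 0" "\<And>s. \<bar>s\<bar> > 2 * P \<Longrightarrow> \<eta> s = 0 \<and> b s = 0"
    "\<And>s. \<bar>s\<bar> \<le> P / 2 \<Longrightarrow> \<eta> s > 0"
    by (rule exists_cutoff[OF \<open>P > 0\<close>]) (rule that; assumption)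
  \<comment> \<open>The time weight lives up to S > T, so it is still positive at T; the equations
    are used up to S' > S, so that the support of the test function is compact in times below
    S'.\<close>
  define S where "S = T + 1"
  define S' where "S' = S + 1"
  \<comment> \<open>For 0 <= t < S the falling factor of \<open>bump (- 3 * S) S\<close> contributes
    at least 1/S^2 to the logarithmic decay, and the rising factor, at distance at least 3S from its
    zero, takes back at most 1/(9 S^2). The difference is c.\<close>
  define c where "c = 8 / 9 / S\<^sup>2"
  define \<theta> where "\<theta> = bump (- 3 * S) S"
  define A where "A = {0..<S'} \<times> (UNIV :: vec3 set)"
  define \<phi> where "\<phi> = tensor \<theta> (\<lambda>_. \<eta>)"
  have "S > 0" "S' > 0" "S < S'" "c > 0" using assms by (auto simp: S_def S'_def c_def)
  have s\<theta>: "smooth1 \<theta>" by (simp add: \<theta>_def smooth1_bump)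
  have \<theta>0: "\<theta> t = 0 \<and> deriv \<theta> t = 0" if "t \<notin> {- 3 * S..S}" for t
    using that by (auto simp: \<theta>_def deriv_bump intro!: bump_zero)
  have decay: "- deriv \<theta> t \<ge> c * \<theta> t" if "t \<ge> 0" for t
  proof (cases "t < S")
    case True
    have "(1 / (S - t))\<^sup>2 \<ge> (1 / S)\<^sup>2" "(1 / (t + 3 * S))\<^sup>2 \<le> (1 / (3 * S))\<^sup>2"
      using that True \<open>S > 0\<close> by (auto intro!: power_mono divide_left_mono)
    then have "1 / (S - t)\<^sup>2 - 1 / (t + 3 * S)\<^sup>2 \<ge> c"
      by (simp add: c_def power_divide power_mult_distrib)
    then have "\<theta> t * c \<le> \<theta> t * (1 / (S - t)\<^sup>2 - 1 / (t + 3 * S)\<^sup>2)"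
      by (intro mult_left_mono) (auto simp: \<theta>_def bump_nonneg)
    then show ?thesis by (simp add: \<theta>_def deriv_bump algebra_simps)
  next
    case False
    then have "\<theta> t = 0" by (simp add: \<theta>_def bump_zero)
    then show ?thesis by (simp add: \<theta>_def deriv_bump)
  qed
  have \<phi>test: "\<phi> \<in> st_test S'"
    unfolding \<phi>_def using \<eta>(5) \<theta>0 \<open>S < S'\<close>
    by (intro tensor_in_st_test[of _ _ "- 3 * S" S S' "2 * P"] s\<theta> \<eta>(1)) auto
  have \<phi>_nonneg: "\<phi> z \<ge> 0" for z
    by (auto simp: \<phi>_def tensor_def \<theta>_def bump_nonneg \<eta>(4) intro!: mult_nonneg_nonneg prod_nonneg)
  have dt\<phi>: "dt \<phi> = tensor (deriv \<theta>) (\<lambda>_. \<eta>)"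
    unfolding \<phi>_def by (intro dt_tensor s\<theta> \<eta>(1))
  have dx\<phi>: "dx i \<phi> = tensor \<theta> ((\<lambda>_. \<eta>)(i := deriv \<eta>))" for i
    unfolding \<phi>_def by (intro dx_tensor s\<theta> \<eta>(1))
  have sm: "smooth1 (((\<lambda>_. \<eta>)(i := h)) j)" if "smooth1 h" for h and i j :: 3
    using that \<eta>(1) by simp
  have dxx\<phi>: "dx i (dx i \<phi>) = tensor \<theta> ((\<lambda>_. \<eta>)(i := deriv (deriv \<eta>)))" for i
    unfolding dx\<phi> by (subst dx_tensor[OF s\<theta> sm[OF smooth1_deriv[OF \<eta>(1)]]]) simp
  have d2\<eta>: "deriv (deriv \<eta>) s = deriv b s - deriv b (s - P)" for s
  proof -
    have "deriv \<eta> = (\<lambda>s. b s - b (s - P))" using \<eta>(3) by blast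
    moreover have "((\<lambda>s. b (s - P)) has_real_derivative deriv b (s - P)) (at s)"
      by (rule DERIV_cong, rule DERIV_chain2[OF smooth1_DERIV[OF \<eta>(2)]])
        (auto intro!: derivative_eq_intros)
    ultimately show ?thesis
      using DERIV_imp_deriv[OF DERIV_diff[OF smooth1_DERIV[OF \<eta>(2)]]] by simp
  qed
  have dt_decay: "- dt \<phi> z \<ge> c * \<phi> z" if "fst z \<ge> 0" for z
  proof -
    have "(\<Prod>j\<in>UNIV. \<eta> (snd z $ j)) * (c * \<theta> (fst z)) \<le> (\<Prod>j\<in>UNIV. \<eta> (snd z $ j)) * (- deriv \<theta> (fst z))"
      by (intro mult_left_mono decay that prod_nonneg) (auto simp: \<eta>(4))
    then show ?thesis unfolding dt\<phi> unfolding \<phi>_def tensor_def by (simp add: algebra_simps)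
  qed
  \<comment> \<open>Covers the weights with factors \<eta>, \<open>b\<close> and
    \<open>deriv b\<close>. The last two stand in for the first and second derivatives of \<eta>,
    because the shift argument asks for integrability before differences are taken.\<close>
  define admissible :: "(3 \<Rightarrow> real \<Rightarrow> real) \<Rightarrow> bool"
    where "admissible g \<longleftrightarrow> (\<forall>j. smooth1 (g j) \<and> (\<forall>s. \<bar>s\<bar> > 2 * P \<longrightarrow> g j s = 0))" for g
  have adm: "admissible (\<lambda>_. \<eta>)" "admissible ((\<lambda>_. \<eta>)(i := b))" "admissible ((\<lambda>_. \<eta>)(i := deriv b))" for i
    using \<eta>(1,2,5) smooth1_deriv[OF \<eta>(2)] deriv_zero_outside[of "2 * P" b]
    by (auto simp: admissible_def)
  have bnd: "\<exists>B. \<forall>z. \<bar>tensor \<tau> g z\<bar> \<le> B" and supp: "snd z \<notin> box2 P \<Longrightarrow> tensor \<tau> g z = 0"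
    and meas: "tensor \<tau> g \<in> borel_measurable borel"
    if \<tau>: "\<tau> = \<theta> \<or> \<tau> = deriv \<theta>" and g: "admissible g" for \<tau> g z
  proof -
    have s\<tau>: "smooth1 \<tau>" using \<tau> s\<theta> smooth1_deriv by blast
    have \<tau>0: "\<tau> t = 0" if "t \<notin> {- 3 * S..S}" for t
      using \<tau> \<theta>0[OF that] by auto
    have g': "\<And>j. smooth1 (g j)" "\<And>j s. \<bar>s\<bar> > 2 * P \<Longrightarrow> g j s = 0"
      using g by (auto simp: admissible_def)
    show "\<exists>B. \<forall>z. \<bar>tensor \<tau> g z\<bar> \<le> B"
      by (rule tensor_bounded[of \<tau> g, OF s\<tau> g'(1) \<tau>0 g'(2)])
    show "snd z \<notin> box2 P \<Longrightarrow> tensor \<tau> g z = 0"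
      by (rule tensor_zero_outside_box2[of P g, OF g'(2)])
    show "tensor \<tau> g \<in> borel_measurable borel"
      by (rule tensor_measurable[of \<tau> g, OF s\<tau> g'(1)])
  qed
  have int: "integrable lborel (\<lambda>z. indicator A z * ((norm (v (fst z) (snd z)))\<^sup>2 * tensor \<tau> g z))"
    if \<tau>: "\<tau> = \<theta> \<or> \<tau> = deriv \<theta>" and g: "admissible g"
      and v: "st_field P v" "Lt_norm 2 S' (Lp_norm P 2) v < top"
    for \<tau> g and v :: "real \<Rightarrow> vec3 \<Rightarrow> vec3"
  proof -
    obtain B where "\<And>z. \<bar>tensor \<tau> g z\<bar> \<le> B" using bnd[OF \<tau> g] by blast
    then show ?thesis
      unfolding A_def using v supp[OF \<tau> g] meas[OF \<tau> g]
      by (intro st_sq_integrable) (auto simp: Lt_norm_2_Lp_norm_2)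
  qed
  \<comment> \<open>A positive minimum of \<phi> over [0, T] times the cell, used at the end to pass
    from the weighted integral to the energy. It is unrelated to the frequency threshold of the
    Kolmogorov assumption.\<close>
  obtain \<kappa> where \<kappa>: "\<kappa> > 0" "\<And>z. z \<in> {0..T} \<times> cell P \<Longrightarrow> \<phi> z \<ge> \<kappa>"
  proof -
    have "compact ({0..T} \<times> cell P)" unfolding cell_def by (intro compact_Times compact_Icc compact_cbox)
    moreover have "(0, 0) \<in> {0..T} \<times> cell P" using assms by (auto simp: mem_cell)
    moreover have "continuous_on ({0..T} \<times> cell P) \<phi>"
      unfolding \<phi>_def by (intro continuous_tensor s\<theta> \<eta>(1))
    ultimately obtain z0 where z0: "z0 \<in> {0..T} \<times> cell P" "\<And>z. z \<in> {0..T} \<times> cell P \<Longrightarrow> \<phi> z0 \<le> \<phi> z"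
      using continuous_attains_inf[of "{0..T} \<times> cell P" \<phi>] by blast
    have "\<phi> z0 > 0"
      using z0(1) \<open>T > 0\<close> unfolding \<phi>_def tensor_def
      by (intro mult_pos_pos prod_pos) (auto simp: mem_cell \<theta>_def S_def intro!: \<eta>(6) bump_pos)
    then show thesis using that z0(2) by blast
  qed
  \<comment> \<open>\<open>m0\<close> and \<open>F\<close> are the contributions of the initial data
    and of the force; both are fixed before the viscosity.\<close>
  define m0 where "m0 = (LINT x|lborel. (norm (u\<^sub>0 x))\<^sup>2 / 2 * \<phi> (0, x))"
  define F where "F = (\<integral>z. indicator A z * ((norm (f (fst z) (snd z)))\<^sup>2 * \<phi> z) \<partial>lborel)"
  have f: "st_field P f" "Lt_norm 2 S' (Lp_norm P 2) f < top"
    using force[OF \<open>S' > 0\<close>] by (auto simp: Lt_Lp_def)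
  have intf: "integrable lborel (\<lambda>z. indicator A z * ((norm (f (fst z) (snd z)))\<^sup>2 * \<phi> z))"
    unfolding \<phi>_def by (intro int adm f) simp
  have "(\<integral>\<^sup>+t\<in>{0<..<T}. energy P (u t) \<partial>lborel) \<le> ennreal (4 / c * (m0 + F / c) / \<kappa>)"
    if "\<mu> > 0" and ns: "ns_weak_solution P u\<^sub>0 f \<mu> u \<pi>" for \<mu> u \<pi>
  proof -
    obtain G where G: "L2_H1_with_gradient P S' u G" "energy_ineq S' u\<^sub>0 f \<mu> u G \<pi>"
      using ns \<open>S' > 0\<close> unfolding ns_weak_solution_def by blast
    have u: "st_field P u" "Lt_norm 2 S' (Lp_norm P 2) u < top"
      using G(1) by (auto simp: L2_H1_with_gradient_def)
    have \<pi>: "st_field P \<pi>" using ns by (simp add: ns_weak_solution_def)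
    have intu: "integrable lborel (\<lambda>z. indicator A z * ((norm (u (fst z) (snd z)))\<^sup>2 * \<phi> z))"
      unfolding \<phi>_def by (intro int adm u) simp
    have intu': "integrable lborel (\<lambda>z. indicator A z * ((norm (u (fst z) (snd z)))\<^sup>2 * dt \<phi> z))"
      unfolding dt\<phi> by (intro int adm u) simp
    let ?q = "\<lambda>i t x. u t x $ i * ((norm (u t x))\<^sup>2 / 2 + \<pi> t x)"
    have flux: "st_int S' (\<lambda>t x. \<Sum>i\<in>UNIV. ?q i t x * dx i \<phi> (t, x)) = 0"
    proof -
      have "has_bochner_integral lborel (\<lambda>z. indicator A z * (?q i (fst z) (snd z) * dx i \<phi> z)) 0" for i
        unfolding dx\<phi> A_def
      proof (rule periodic_integral_shift_diff)
        show "periodic P (?q i t)" if "t \<ge> 0" for t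
          using u(1) \<pi> that by (simp add: st_field_def periodic_def)
        let ?w = "tensor \<theta> ((\<lambda>_. \<eta>)(i := b))"
        obtain B where B: "\<And>z. \<bar>?w z\<bar> \<le> B" using bnd[OF disjI1[OF refl] adm(2)] by blast
        \<comment> \<open>For nonnegative times the weight \<open>?w\<close> vanishes off this
          compact set, so the local integrability of the energy flux recorded in
          \<open>energy_ineq\<close>, together with the boundedness of \<open>?w\<close>, makes the
          product integrable on the slab.\<close>
        let ?K = "{0..S} \<times> box2 P"
        let ?Q = "\<lambda>z. ((norm (u (fst z) (snd z)))\<^sup>2 / 2 + \<pi> (fst z) (snd z)) *\<^sub>R u (fst z) (snd z)"
        have "compact ?K" unfolding box2_def by (intro compact_Times compact_Icc compact_cbox)
        moreover have "?K \<subseteq> {0..<S'} \<times> UNIV" using \<open>S < S'\<close> by auto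
        ultimately have "set_integrable lborel ?K ?Q"
          using G(2) by (simp add: energy_ineq_def locally_integrable_def)
        then have "integrable lborel (\<lambda>z. (indicator ?K z *\<^sub>R ?Q z) $ i)"
          unfolding set_integrable_def by (rule integrable_bounded_linear[OF bounded_linear_vec_nth])
        then have intK: "integrable lborel (\<lambda>z. indicator ?K z * ?q i (fst z) (snd z))"
          by (simp add: mult_ac)
        have w0: "?w z = 0" if "z \<notin> ?K" "fst z \<ge> 0" for z
        proof (cases "fst z \<in> {0..S}")
          case True
          then have "snd z \<notin> box2 P" using that by (simp add: mem_Times_iff)
          then show ?thesis by (rule supp[OF disjI1[OF refl] adm(2)])
        next
          case False
          then have "\<theta> (fst z) = 0" using that \<theta>0[of "fst z"] by auto
          then show ?thesis by (simp add: tensor_def)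
        qed
        have "indicator ({0..<S'} \<times> UNIV) z * (?q i (fst z) (snd z) * ?w z)
            = indicator ?K z * ?q i (fst z) (snd z) * ?w z" for z
          using w0[of z] \<open>S < S'\<close> by (cases z) (auto split: split_indicator)
        moreover have "integrable lborel (\<lambda>z. indicator ?K z * ?q i (fst z) (snd z) * ?w z)"
        proof (rule Bochner_Integration.integrable_bound)
          show "integrable lborel (\<lambda>z. B * (indicator ?K z * ?q i (fst z) (snd z)))"
            using intK by simp
          show "(\<lambda>z. indicator ?K z * ?q i (fst z) (snd z) * ?w z) \<in> borel_measurable lborel"
            using borel_measurable_times[OF borel_measurable_integrable[OF intK], of ?w]
              meas[OF disjI1[OF refl] adm(2)] by simp
          show "AE z in lborel. norm (indicator ?K z * ?q i (fst z) (snd z) * ?w z)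
              \<le> norm (B * (indicator ?K z * ?q i (fst z) (snd z)))"
          proof (intro AE_I2)
            fix z
            have "\<bar>indicator ?K z * ?q i (fst z) (snd z)\<bar> * \<bar>?w z\<bar>
                \<le> \<bar>indicator ?K z * ?q i (fst z) (snd z)\<bar> * \<bar>B\<bar>"
              using B[of z] by (intro mult_left_mono) auto
            then show "norm (indicator ?K z * ?q i (fst z) (snd z) * ?w z)
                \<le> norm (B * (indicator ?K z * ?q i (fst z) (snd z)))"
              by (simp only: real_norm_def abs_mult mult_ac)
          qed
        qed
        ultimately show "integrable lborel (\<lambda>z. indicator ({0..<S'} \<times> UNIV) z * (?q i (fst z) (snd z) * ?w z))"
          by (simp only:)
        show "deriv \<eta> s = b s - b (s - P)" for s by (rule \<eta>(3))
      qed
      then have "has_bochner_integral lborel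
          (\<lambda>z. \<Sum>i\<in>UNIV. indicator A z * (?q i (fst z) (snd z) * dx i \<phi> z)) (\<Sum>i\<in>(UNIV::3 set). 0)"
        by (rule has_bochner_integral_sum)
      then show ?thesis
        by (simp add: st_int_def set_lebesgue_integral_def A_def sum_distrib_left has_bochner_integral_iff)
    qed
    \<comment> \<open>The same cancellation one derivative higher: in each direction the second
      derivative is a difference of translates of \<open>deriv b\<close>, and the periodic factor is
      now the square of the speed.\<close>
    have lap: "st_int S' (\<lambda>t x. (norm (u t x))\<^sup>2 / 2 * laplace_x \<phi> (t, x)) = 0"
    proof -
      have "has_bochner_integral lborel
          (\<lambda>z. indicator A z * ((norm (u (fst z) (snd z)))\<^sup>2 * dx i (dx i \<phi>) z)) 0" for i
        unfolding dxx\<phi> A_def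
      proof (rule periodic_integral_shift_diff[where q = "\<lambda>t x. (norm (u t x))\<^sup>2"])
        show "periodic P (\<lambda>x. (norm (u t x))\<^sup>2)" if "t \<ge> 0" for t
          using u(1) that by (simp add: st_field_def periodic_def)
        show "integrable lborel (\<lambda>z. indicator ({0..<S'} \<times> UNIV) z *
            ((norm (u (fst z) (snd z)))\<^sup>2 * tensor \<theta> ((\<lambda>_. \<eta>)(i := deriv b)) z))"
          unfolding A_def[symmetric]
          by (intro int u adm) simp
      qed (rule d2\<eta>)
      then have "has_bochner_integral lborel
          (\<lambda>z. \<Sum>i\<in>UNIV. indicator A z * ((norm (u (fst z) (snd z)))\<^sup>2 * dx i (dx i \<phi>) z)) (\<Sum>i\<in>(UNIV::3 set). 0)"
        by (rule has_bochner_integral_sum)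
      then have "has_bochner_integral lborel
          (\<lambda>z. (\<Sum>i\<in>UNIV. indicator A z * ((norm (u (fst z) (snd z)))\<^sup>2 * dx i (dx i \<phi>) z)) / 2)
          ((\<Sum>i\<in>(UNIV::3 set). 0) / 2)"
        by (rule has_bochner_integral_divide_zero)
      moreover have "indicator A z *\<^sub>R ((norm (u (fst z) (snd z)))\<^sup>2 / 2 * laplace_x \<phi> (fst z, snd z))
          = (\<Sum>i\<in>UNIV. indicator A z * ((norm (u (fst z) (snd z)))\<^sup>2 * dx i (dx i \<phi>) z)) / 2" for z
        by (simp only: laplace_x_def sum_distrib_left sum_divide_distrib prod.collapse) (simp split: split_indicator)
      ultimately show ?thesis
        by (simp only: st_int_def set_lebesgue_integral_def A_def[symmetric] has_bochner_integral_iff) simp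
    qed
    \<comment> \<open>With diffusion gone, this is the only term through which \<mu> could enter;
      its sign allows it to be dropped.\<close>
    have diss: "\<mu> * st_int S' (\<lambda>t x. (norm (G t x))\<^sup>2 * \<phi> (t, x)) \<ge> 0"
      unfolding st_int_def set_lebesgue_integral_def using \<open>\<mu> > 0\<close> \<phi>_nonneg
      by (intro mult_nonneg_nonneg integral_nonneg_AE) auto
    have "- st_int S' (\<lambda>t x. (norm (u t x))\<^sup>2 / 2 * dt \<phi> (t, x)) - m0
        - st_int S' (\<lambda>t x. \<Sum>i\<in>UNIV. ?q i t x * dx i \<phi> (t, x))
        + \<mu> * st_int S' (\<lambda>t x. (norm (G t x))\<^sup>2 * \<phi> (t, x))
        - \<mu> * st_int S' (\<lambda>t x. (norm (u t x))\<^sup>2 / 2 * laplace_x \<phi> (t, x))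
        \<le> st_int S' (\<lambda>t x. (f t x \<bullet> u t x) * \<phi> (t, x))"
      using G(2) \<phi>test \<phi>_nonneg unfolding energy_ineq_def m0_def by blast
    then have ineq: "- st_int S' (\<lambda>t x. (norm (u t x))\<^sup>2 / 2 * dt \<phi> (t, x))
        \<le> m0 + st_int S' (\<lambda>t x. (f t x \<bullet> u t x) * \<phi> (t, x))"
      using flux lap diss by simp
    define U where "U = (\<integral>z. indicator A z * ((norm (u (fst z) (snd z)))\<^sup>2 * \<phi> z) \<partial>lborel)"
    have nonneg: "indicator A z * ((norm (u (fst z) (snd z)))\<^sup>2 * \<phi> z) \<ge> 0"
      "indicator A z * ((norm (f (fst z) (snd z)))\<^sup>2 * \<phi> z) \<ge> 0" for z
      using \<phi>_nonneg by auto
    have "c / 2 * U \<le> - st_int S' (\<lambda>t x. (norm (u t x))\<^sup>2 / 2 * dt \<phi> (t, x))"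
    proof -
      have "c / 2 * U = (\<integral>z. c / 2 * (indicator A z * ((norm (u (fst z) (snd z)))\<^sup>2 * \<phi> z)) \<partial>lborel)"
        by (simp add: U_def)
      also have "\<dots> \<le> (\<integral>z. (- 1 / 2) * (indicator A z * ((norm (u (fst z) (snd z)))\<^sup>2 * dt \<phi> z)) \<partial>lborel)"
      proof (intro integral_mono integrable_mult_right intu intu')
        fix z :: "real \<times> vec3"
        have "(norm (u (fst z) (snd z)))\<^sup>2 * (c * \<phi> z) \<le> (norm (u (fst z) (snd z)))\<^sup>2 * (- dt \<phi> z)"
          if "z \<in> A"
          using that by (intro mult_left_mono dt_decay) (auto simp: A_def)
        then show "c / 2 * (indicator A z * ((norm (u (fst z) (snd z)))\<^sup>2 * \<phi> z))
            \<le> (- 1 / 2) * (indicator A z * ((norm (u (fst z) (snd z)))\<^sup>2 * dt \<phi> z))"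
          by (auto simp: mult.left_commute split: split_indicator)
      qed
      also have "\<dots> = - st_int S' (\<lambda>t x. (norm (u t x))\<^sup>2 / 2 * dt \<phi> (t, x))"
        by (simp add: st_int_def set_lebesgue_integral_def A_def)
      finally show ?thesis .
    qed
    moreover have "st_int S' (\<lambda>t x. (f t x \<bullet> u t x) * \<phi> (t, x)) \<le> F / c + c / 4 * U"
    proof -
      have "st_int S' (\<lambda>t x. (f t x \<bullet> u t x) * \<phi> (t, x))
          = (\<integral>z. indicator A z * ((f (fst z) (snd z) \<bullet> u (fst z) (snd z)) * \<phi> z) \<partial>lborel)"
        by (simp add: st_int_def set_lebesgue_integral_def A_def)
      also have "\<dots> \<le> (\<integral>z. (indicator A z * ((norm (f (fst z) (snd z)))\<^sup>2 * \<phi> z)) / c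
          + c / 4 * (indicator A z * ((norm (u (fst z) (snd z)))\<^sup>2 * \<phi> z)) \<partial>lborel)"
      \<comment> \<open>In this form no integrability of \<open>f \<bullet> u\<close> is required, as a non-integrable function has integral 0.\<close>
      proof (rule integral_mono')
        show "integrable lborel (\<lambda>z. (indicator A z * ((norm (f (fst z) (snd z)))\<^sup>2 * \<phi> z)) / c
          + c / 4 * (indicator A z * ((norm (u (fst z) (snd z)))\<^sup>2 * \<phi> z)))"
          using intf intu by (intro Bochner_Integration.integrable_add integrable_mult_right integrable_divide) auto
        fix z :: "real \<times> vec3"
        have "(f (fst z) (snd z) \<bullet> u (fst z) (snd z)) * \<phi> z
            \<le> ((norm (f (fst z) (snd z)))\<^sup>2 / c + c / 4 * (norm (u (fst z) (snd z)))\<^sup>2) * \<phi> z"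
          using \<phi>_nonneg \<open>c > 0\<close> by (intro mult_right_mono young_weighted)
        then show "indicator A z * ((f (fst z) (snd z) \<bullet> u (fst z) (snd z)) * \<phi> z)
            \<le> (indicator A z * ((norm (f (fst z) (snd z)))\<^sup>2 * \<phi> z)) / c
              + c / 4 * (indicator A z * ((norm (u (fst z) (snd z)))\<^sup>2 * \<phi> z))"
          by (simp add: distrib_right split: split_indicator)
        show "0 \<le> (indicator A z * ((norm (f (fst z) (snd z)))\<^sup>2 * \<phi> z)) / c
              + c / 4 * (indicator A z * ((norm (u (fst z) (snd z)))\<^sup>2 * \<phi> z))"
          using \<phi>_nonneg[of z] \<open>c > 0\<close> by (intro add_nonneg_nonneg mult_nonneg_nonneg divide_nonneg_pos) auto
      qed
      also have "\<dots> = F / c + c / 4 * U"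
        unfolding F_def U_def using intf intu
        by (subst Bochner_Integration.integral_add) auto
      finally show ?thesis .
    qed
    \<comment> \<open>The decay gives c/2 U on the left and Young's inequality costs c/4 U on the
      right. Subtracting is legitimate because U is a real number, the integral of an integrable
      function.\<close>
    ultimately have "c / 4 * U \<le> m0 + F / c" using ineq by linarith
    then have "U \<le> 4 / c * (m0 + F / c)"
      using mult_left_mono[of "c / 4 * U" "m0 + F / c" "4 / c"] \<open>c > 0\<close> by simp
    moreover have "(\<integral>\<^sup>+t\<in>{0<..<T}. energy P (u t) \<partial>lborel) \<le> ennreal (U / \<kappa>)"
    proof -
      define V where "V z = indicator ({0<..<T} \<times> UNIV) z *\<^sub>R u (fst z) (snd z)" for z
      have V[measurable]: "V \<in> borel_measurable borel"
        unfolding V_def by (intro st_field_slab_measurable[OF u(1)] borel_Times) auto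
      have [measurable]: "(\<lambda>z::real \<times> vec3. indicator (cell P) (snd z) :: ennreal) \<in> borel_measurable borel"
        unfolding borel_prod[symmetric] by measurable
      have "(\<integral>\<^sup>+t\<in>{0<..<T}. energy P (u t) \<partial>lborel)
          = (\<integral>\<^sup>+t. \<integral>\<^sup>+x. ennreal ((norm (V (t, x)))\<^sup>2) * indicator (cell P) x \<partial>lborel \<partial>lborel)"
        by (intro nn_integral_cong) (simp add: V_def energy_def indicator_times split: split_indicator)
      also have "\<dots> = (\<integral>\<^sup>+z. ennreal ((norm (V z))\<^sup>2) * indicator (cell P) (snd z) \<partial>lborel)"
        using nn_integral_lborel_prod[of "\<lambda>z. ennreal ((norm (V z))\<^sup>2) * indicator (cell P) (snd z)"] by simp
      also have "\<dots> \<le> (\<integral>\<^sup>+z. ennreal ((indicator A z * ((norm (u (fst z) (snd z)))\<^sup>2 * \<phi> z)) / \<kappa>) \<partial>lborel)"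
      proof (intro nn_integral_mono)
        fix z :: "real \<times> vec3"
        show "ennreal ((norm (V z))\<^sup>2) * indicator (cell P) (snd z)
            \<le> ennreal ((indicator A z * ((norm (u (fst z) (snd z)))\<^sup>2 * \<phi> z)) / \<kappa>)"
        proof (cases "fst z \<in> {0<..<T} \<and> snd z \<in> cell P")
          case True
          then have "z \<in> {0..T} \<times> cell P" "z \<in> A" "z \<in> {0<..<T} \<times> UNIV"
            by (cases z; auto simp: A_def S'_def S_def)+
          moreover have "(norm (u (fst z) (snd z)))\<^sup>2 * \<kappa> \<le> (norm (u (fst z) (snd z)))\<^sup>2 * \<phi> z"
            using \<kappa>(2)[OF \<open>z \<in> {0..T} \<times> cell P\<close>] by (intro mult_left_mono) auto
          ultimately show ?thesis
            using \<open>\<kappa> > 0\<close> by (auto simp: V_def field_simps intro!: ennreal_leI)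
        next
          case False
          then have "ennreal ((norm (V z))\<^sup>2) * indicator (cell P) (snd z) = 0"
            by (cases z) (auto simp: V_def)
          then show ?thesis by (rule ord_eq_le_trans) simp
        qed
      qed
      also have "\<dots> = ennreal (U / \<kappa>)"
        unfolding U_def using intu nonneg(1) \<open>\<kappa> > 0\<close>
        by (subst nn_integral_eq_integral) (auto intro!: divide_nonneg_pos)
      finally show ?thesis .
    qed
    ultimately show ?thesis
      using \<open>\<kappa> > 0\<close> by (meson divide_right_mono ennreal_leI less_imp_le order_trans)
  qed
  then show ?thesis by blast
qed

section \<open>Fourier coefficients\<close>

lemma measure_cell: "P > 0 \<Longrightarrow> measure lborel (cell P) = P ^ 3"
  by (simp add: cell_def content_cbox_cart interval_ne_empty_cart prod_constant)

lemma power2_norm_vec: "(norm (x :: 'a::real_normed_vector ^ 'n))\<^sup>2 = (\<Sum>i\<in>UNIV. (norm (x $ i))\<^sup>2)"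
  by (simp add: norm_vec_def L2_set_def sum_nonneg)

lemma borel_measurable_vec_nth [measurable (raw)]:
  fixes f :: "'a \<Rightarrow> real ^ 'n"
  assumes "f \<in> borel_measurable M"
  shows "(\<lambda>x. f x $ j) \<in> borel_measurable M"
  by (rule measurable_compose[OF assms], intro borel_measurable_continuous_onI continuous_intros)

text \<open>Cauchy-Schwarz against the constant 1, obtained from the nonnegativity of the integral
  of (g - m)^2 with m the mean of g over A.\<close>

lemma square_set_integral_le:
  fixes g :: "'a \<Rightarrow> real"
  assumes A: "A \<in> sets M" "emeasure M A < \<infinity>" "measure M A > 0"
    and g: "set_integrable M A g" and g2: "set_integrable M A (\<lambda>x. (g x)\<^sup>2)"
  shows "(LINT x:A|M. g x)\<^sup>2 \<le> measure M A * (LINT x:A|M. (g x)\<^sup>2)"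
proof -
  define I where "I = (LINT x:A|M. g x)"
  define m where "m = I / measure M A"
  have c: "set_integrable M A (\<lambda>x. m\<^sup>2)" using A by (simp add: set_integrable_def)
  have "0 \<le> (LINT x:A|M. (g x - m)\<^sup>2)"
    by (auto simp: set_lebesgue_integral_def intro!: integral_nonneg_AE)
  also have "\<dots> = (LINT x:A|M. ((g x)\<^sup>2 - 2 * m * g x) + m\<^sup>2)"
    by (intro set_lebesgue_integral_cong) (use A in \<open>auto simp: power2_diff algebra_simps\<close>)
  also have "\<dots> = (LINT x:A|M. (g x)\<^sup>2) - 2 * m * I + measure M A * m\<^sup>2"
    using g g2 c A by (simp add: I_def set_integral_add set_integral_diff set_integral_const)
  also have "\<dots> = (LINT x:A|M. (g x)\<^sup>2) - I\<^sup>2 / measure M A"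
    using A(3) by (simp add: m_def field_simps power2_eq_square)
  finally show ?thesis using A(3) by (simp add: I_def field_simps)
qed

text \<open>The exponential has modulus 1, so Cauchy-Schwarz over the cell bounds the square of each
  component's integral by P^3 times the energy; the normalisation divides by P^6. Bounding each of
  the three components by the full energy gives the factor 3.\<close>

lemma fourier_bound:
  assumes "P > 0" and [measurable]: "v \<in> borel_measurable borel"
  shows "ennreal ((norm (fourier P v k))\<^sup>2) \<le> ennreal (3 / P ^ 3) * energy P v"
proof (cases "energy P v = top")
  case True
  then show ?thesis using assms by (simp add: ennreal_mult_top)
next
  case False
  have cell: "cell P \<in> sets lborel" "emeasure lborel (cell P) < \<infinity>" "measure lborel (cell P) > 0"
    using assms emeasure_lborel_cbox_finite[of "(\<chi> i. - P / 2) :: vec3" "\<chi> i. P / 2"]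
    by (simp_all add: measure_cell) (simp add: cell_def)
  have sq: "set_integrable lborel (cell P) (\<lambda>x. (norm (v x))\<^sup>2)"
    unfolding set_integrable_def
  proof (rule integrableI_bounded)
    have "(\<integral>\<^sup>+x. ennreal (norm (indicator (cell P) x *\<^sub>R (norm (v x))\<^sup>2)) \<partial>lborel) = energy P v"
      unfolding energy_def by (intro nn_integral_cong) (simp split: split_indicator)
    then show "(\<integral>\<^sup>+x. ennreal (norm (indicator (cell P) x *\<^sub>R (norm (v x))\<^sup>2)) \<partial>lborel) < \<infinity>"
      using False by (simp add: less_top)
  qed measurable
  define E where "E = (LINT x:cell P|lborel. (norm (v x))\<^sup>2)"
  have E: "energy P v = ennreal E"
  proof -
    have "energy P v = (\<integral>\<^sup>+x. ennreal (indicator (cell P) x *\<^sub>R (norm (v x))\<^sup>2) \<partial>lborel)"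
      unfolding energy_def by (intro nn_integral_cong) (simp split: split_indicator)
    also have "\<dots> = ennreal E"
      using sq unfolding E_def set_lebesgue_integral_def set_integrable_def
      by (intro nn_integral_eq_integral) auto
    finally show ?thesis .
  qed
  have comp: "(norm (fourier P v k $ j))\<^sup>2 \<le> E / P ^ 3" for j
  proof -
    let ?h = "\<lambda>x. complex_of_real (v x $ j) * exp (- (\<i> * complex_of_real (k \<bullet> x)))"
    have h: "norm (?h x) = \<bar>v x $ j\<bar>" for x by (simp add: norm_mult)
    have le: "\<bar>v x $ j\<bar>\<^sup>2 \<le> (norm (v x))\<^sup>2" for x
      by (intro power_mono component_le_norm_cart) simp
    have vj2: "set_integrable lborel (cell P) (\<lambda>x. \<bar>v x $ j\<bar>\<^sup>2)"
    proof (rule set_integrable_bound[OF sq])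
      show "set_borel_measurable lborel (cell P) (\<lambda>x. \<bar>v x $ j\<bar>\<^sup>2)"
        unfolding set_borel_measurable_def by measurable
    qed (use le in auto)
    have "set_integrable lborel (cell P) (\<lambda>x. 1 + \<bar>v x $ j\<bar>\<^sup>2)"
      using cell vj2 by (intro set_integral_add) (simp_all add: set_integrable_def)
    then have vj: "set_integrable lborel (cell P) (\<lambda>x. \<bar>v x $ j\<bar>)"
    proof (rule set_integrable_bound)
      have "\<bar>y\<bar> \<le> 1 + y\<^sup>2" for y :: real
        using zero_le_power2[of "\<bar>y\<bar> - 1"] by (simp add: power2_diff)
      then show "AE x in lborel. x \<in> cell P \<longrightarrow> norm \<bar>v x $ j\<bar> \<le> norm (1 + \<bar>v x $ j\<bar>\<^sup>2)"
        by auto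
      show "set_borel_measurable lborel (cell P) (\<lambda>x. \<bar>v x $ j\<bar>)"
        unfolding set_borel_measurable_def by measurable
    qed
    have "norm (LINT x:cell P|lborel. ?h x) \<le> (LINT x:cell P|lborel. norm (?h x))"
      unfolding set_lebesgue_integral_def by (rule order_trans[OF integral_norm_bound]) simp
    then have "(norm (LINT x:cell P|lborel. ?h x))\<^sup>2 \<le> (LINT x:cell P|lborel. \<bar>v x $ j\<bar>)\<^sup>2"
      unfolding h by (intro power_mono) auto
    also have "\<dots> \<le> P ^ 3 * (LINT x:cell P|lborel. \<bar>v x $ j\<bar>\<^sup>2)"
      using square_set_integral_le[OF cell vj vj2] by (simp add: measure_cell assms)
    also have "\<dots> \<le> P ^ 3 * E"
      unfolding E_def using assms
      by (intro mult_left_mono set_integral_mono vj2 sq le) auto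
    finally have "(norm (LINT x:cell P|lborel. ?h x))\<^sup>2 \<le> P ^ 3 * E" .
    moreover have "norm (fourier P v k $ j) = norm (LINT x:cell P|lborel. ?h x) / P ^ 3"
      using assms by (simp add: fourier_def measure_cell norm_mult norm_divide norm_power)
    ultimately have "(norm (fourier P v k $ j))\<^sup>2 \<le> P ^ 3 * E / (P ^ 3)\<^sup>2"
      by (simp only: power_divide) (intro divide_right_mono, simp_all)
    also have "\<dots> = E / P ^ 3" using assms by (simp add: field_simps flip: power_add)
    finally show ?thesis .
  qed
  have "(norm (fourier P v k))\<^sup>2 \<le> (\<Sum>j\<in>(UNIV::3 set). E / P ^ 3)"
    unfolding power2_norm_vec by (intro sum_mono comp)
  then have "ennreal ((norm (fourier P v k))\<^sup>2) \<le> ennreal (3 / P ^ 3 * E)"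
    by (intro ennreal_leI) simp
  also have "\<dots> = ennreal (3 / P ^ 3) * energy P v"
    unfolding E using assms by (intro ennreal_mult') simp
  finally show ?thesis .
qed

text \<open>Parametrised integration applies to the extension by 0 from the slab, whose coefficients
  are those of v on (0, T) and 0 elsewhere.\<close>

lemma fourier_measurable:
  assumes "st_field P v"
  shows "(\<lambda>t. ennreal ((norm (fourier P (v t) k))\<^sup>2) * indicator {0<..<T} t) \<in> borel_measurable borel"
proof -
  define V where "V z = indicator ({0<..<T} \<times> UNIV) z *\<^sub>R v (fst z) (snd z)" for z
  have [measurable]: "V \<in> borel_measurable (borel \<Otimes>\<^sub>M lborel)"
    unfolding V_def using st_field_slab_measurable_pair[OF assms] .
  have "(\<lambda>t. fourier P (\<lambda>x. V (t, x)) k $ j) \<in> borel_measurable borel" for j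
    unfolding fourier_def set_lebesgue_integral_def vec_lambda_beta
    using measurable_snd[of "borel :: real measure" "lborel :: vec3 measure"] by measurable
  then have "(\<lambda>t. ennreal ((norm (fourier P (\<lambda>x. V (t, x)) k))\<^sup>2)) \<in> borel_measurable borel"
    unfolding power2_norm_vec by measurable
  moreover have "ennreal ((norm (fourier P (\<lambda>x. V (t, x)) k))\<^sup>2)
      = ennreal ((norm (fourier P (v t) k))\<^sup>2) * indicator {0<..<T} t" for t
  proof (cases "t \<in> {0<..<T}")
    case True
    then have "(\<lambda>x. V (t, x)) = v t" by (simp add: V_def)
    then show ?thesis using True by simp
  next
    case False
    then have "(\<lambda>x. V (t, x)) = (\<lambda>x. 0)" by (auto simp: V_def)
    then show ?thesis using False by (simp add: power2_norm_vec fourier_def set_lebesgue_integral_def)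
  qed
  ultimately show ?thesis by simp
qed

section \<open>Lattice sums\<close>

text \<open>Every finite partial sum is dominated by the integral. This turns the sum in
  \<open>H_norm\<close> into an integral over counting measure, to which Tonelli applies.\<close>

lemma infsum_le_nn_integral_count_space:
  fixes f :: "'a \<Rightarrow> ennreal"
  shows "(\<Sum>\<^sub>\<infinity>k\<in>A. f k) \<le> (\<integral>\<^sup>+k. f k \<partial>count_space A)"
proof -
  have "sum f F \<le> (\<integral>\<^sup>+k. f k \<partial>count_space A)" if "finite F" "F \<subseteq> A" for F
  proof -
    have "sum f F = (\<integral>\<^sup>+k. f k * indicator F k \<partial>count_space A)"
      using that by (subst nn_integral_count_space'[of F]) (auto simp: indicator_def)
    also have "\<dots> \<le> (\<integral>\<^sup>+k. f k \<partial>count_space A)"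
      by (intro nn_integral_mono) (simp split: split_indicator)
    finally show ?thesis .
  qed
  then show ?thesis by (subst nonneg_infsum_complete) (auto intro!: SUP_least)
qed

text \<open>Two copies of a convergent p-series, one for each sign; the integer 0 is counted in
  both, whence an inequality at the split.\<close>

lemma nn_integral_int_powr_finite:
  assumes "\<delta> > 0"
  shows "(\<integral>\<^sup>+n. ennreal ((1 + \<bar>of_int n\<bar>) powr (- (1 + \<delta>))) \<partial>count_space (UNIV :: int set)) < top"
proof -
  let ?f = "\<lambda>n::int. ennreal ((1 + \<bar>of_int n\<bar>) powr (- (1 + \<delta>)))"
  have nat: "(\<integral>\<^sup>+n. ennreal ((1 + real n) powr (- (1 + \<delta>))) \<partial>count_space UNIV) < top"
  proof -
    have "summable (\<lambda>n. real (Suc n) powr (- (1 + \<delta>)))"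
      using assms by (subst summable_Suc_iff) (simp add: summable_real_powr_iff)
    then have "(\<Sum>n. ennreal ((1 + real n) powr (- (1 + \<delta>)))) \<noteq> top"
      by (intro ennreal_suminf_neq_top) (simp_all add: add.commute)
    then show ?thesis by (simp add: nn_integral_count_space_nat less_top)
  qed
  have "(\<integral>\<^sup>+n. ?f n \<partial>count_space (UNIV :: int set))
      \<le> (\<integral>\<^sup>+n. ?f n * indicator {0..} n + ?f n * indicator {..0} n \<partial>count_space UNIV)"
    by (intro nn_integral_mono) (auto split: split_indicator)
  also have "\<dots> = (\<integral>\<^sup>+n. ?f n \<partial>count_space {0..}) + (\<integral>\<^sup>+n. ?f n \<partial>count_space {..0})"
    by (simp add: nn_integral_add nn_integral_count_space_indicator)
  also have "(\<integral>\<^sup>+n. ?f n \<partial>count_space {0..}) = (\<integral>\<^sup>+n. ?f (int n) \<partial>count_space UNIV)"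
    by (rule nn_integral_bij_count_space[symmetric])
      (auto simp: bij_betw_def inj_on_def image_def intro: nonneg_int_cases)
  also have "(\<integral>\<^sup>+n. ?f n \<partial>count_space {..0}) = (\<integral>\<^sup>+n. ?f (- int n) \<partial>count_space UNIV)"
    by (rule nn_integral_bij_count_space[symmetric])
      (auto simp: bij_betw_def inj_on_def image_def intro: nonpos_int_cases)
  finally show ?thesis using nat by (simp add: le_less_trans)
qed

text \<open>Indexing by nested pairs instead of \<open>int^3\<close> lets a sum over the lattice be
  iterated coordinate by coordinate.\<close>

definition wave_vector :: "real \<Rightarrow> int \<times> int \<times> int \<Rightarrow> vec3" where
  "wave_vector P = (\<lambda>(a, b, c). \<chi> i. 2 * pi / P * real_of_int (vector [a, b, c] $ i))"

lemma bij_betw_wave_vector: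
  assumes "P > 0"
  shows "bij_betw (wave_vector P) UNIV (wave_vectors P)"
proof (rule bij_betwI')
  show "(wave_vector P x = wave_vector P y) = (x = y)" for x y
    using assms by (cases x; cases y) (auto simp: wave_vector_def vec_eq_iff forall_3)
  show "wave_vector P x \<in> wave_vectors P" for x
    by (cases x) (auto simp: wave_vector_def wave_vectors_def)
  show "\<exists>x\<in>UNIV. k = wave_vector P x" if "k \<in> wave_vectors P" for k
  proof -
    obtain m :: "int^3" where "k = (\<chi> i. 2 * pi / P * real_of_int (m $ i))"
      using \<open>k \<in> wave_vectors P\<close> by (auto simp: wave_vector_def wave_vectors_def)
    then show ?thesis
      by (intro bexI[of _ "(m $ 1, m $ 2, m $ 3)"]) (auto simp: wave_vector_def vec_eq_iff forall_3)
  qed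
qed

text \<open>Each integer coordinate n_i of k satisfies 1 + |n_i| <= D (1 + norm k) with D = 1 + P/(2
  pi). Splitting the exponent 3 + 3 \<delta> evenly over the three coordinates dominates the summand
  by a product of one-dimensional terms, and the sum by the cube of a convergent series.\<close>

lemma lattice_sum_finite:
  assumes "P > 0" "\<delta> > 0"
  shows "(\<integral>\<^sup>+k. ennreal ((1 + norm k) powr (- (3 + 3 * \<delta>))) \<partial>count_space (wave_vectors P)) < top"
proof -
  let ?w = "\<lambda>n::int. (1 + \<bar>of_int n\<bar>) powr (- (1 + \<delta>)) :: real"
  let ?k = "wave_vector P"
  define q where "q = P / (2 * pi)"
  define D where "D = 1 + q"
  have "q \<ge> 0" "D > 0" using assms by (simp_all add: D_def q_def add_pos_nonneg)
  have bound: "(1 + norm (?k (a, b, c))) powr (- (3 + 3 * \<delta>)) \<le> D powr (3 + 3 * \<delta>) * (?w a * (?w b * ?w c))" for a b c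
  proof -
    define r where "r = norm (?k (a, b, c))"
    have comp: "1 + \<bar>of_int (vector [a, b, c] $ i)\<bar> \<le> D * (1 + r)" for i :: 3
    proof -
      have "\<bar>?k (a, b, c) $ i\<bar> \<le> r" unfolding r_def by (rule component_le_norm_cart)
      then have "2 * pi / P * \<bar>of_int (vector [a, b, c] $ i)\<bar> \<le> r"
        using assms by (simp add: wave_vector_def abs_mult)
      then have "\<bar>of_int (vector [a, b, c] $ i)\<bar> \<le> q * r"
        using assms by (simp add: q_def field_simps)
      moreover have "r \<ge> 0" by (simp add: r_def)
      ultimately show ?thesis using \<open>q \<ge> 0\<close> by (simp add: D_def algebra_simps)
    qed
    have w: "(D * (1 + r)) powr (- (1 + \<delta>)) \<le> ?w (vector [a, b, c] $ i)" for i :: 3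
      using assms by (intro powr_mono2' comp) auto
    have "(1 + r) powr (- e) = D powr e * (D * (1 + r)) powr (- e)" for e
      using \<open>D > 0\<close> by (simp add: r_def powr_mult powr_minus)
    then have "(1 + r) powr (- (3 + 3 * \<delta>)) = D powr (3 + 3 * \<delta>) * (D * (1 + r)) powr (- (3 + 3 * \<delta>))"
      by blast
    also have "(D * (1 + r)) powr (- (3 + 3 * \<delta>)) = (D * (1 + r)) powr (- (1 + \<delta>)) *
        ((D * (1 + r)) powr (- (1 + \<delta>)) * (D * (1 + r)) powr (- (1 + \<delta>)))"
      by (simp add: powr_add[symmetric])
    also have "\<dots> \<le> ?w a * (?w b * ?w c)"
      using w[of 1] w[of 2] w[of 3] by (intro mult_mono) auto
    finally show ?thesis by (simp add: r_def mult_left_mono)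
  qed
  have "(\<integral>\<^sup>+k. ennreal ((1 + norm k) powr (- (3 + 3 * \<delta>))) \<partial>count_space (wave_vectors P))
      = (\<integral>\<^sup>+x. ennreal ((1 + norm (?k x)) powr (- (3 + 3 * \<delta>))) \<partial>count_space UNIV)"
    by (rule nn_integral_bij_count_space[OF bij_betw_wave_vector[OF assms(1)], symmetric])
  also have "\<dots> \<le> (\<integral>\<^sup>+(a, b, c). ennreal (D powr (3 + 3 * \<delta>)) * (ennreal (?w a) * (ennreal (?w b) * ennreal (?w c))) \<partial>count_space UNIV)"
  proof (intro nn_integral_mono)
    fix x :: "int \<times> int \<times> int"
    show "ennreal ((1 + norm (?k x)) powr (- (3 + 3 * \<delta>))) \<le> (case x of (a, b, c) \<Rightarrow>
        ennreal (D powr (3 + 3 * \<delta>)) * (ennreal (?w a) * (ennreal (?w b) * ennreal (?w c))))"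
      using bound by (cases x) (simp add: ennreal_mult'[symmetric] ennreal_leI)
  qed
  also have "\<dots> = ennreal (D powr (3 + 3 * \<delta>)) * ((\<integral>\<^sup>+a. ennreal (?w a) \<partial>count_space UNIV) *
      ((\<integral>\<^sup>+b. ennreal (?w b) \<partial>count_space UNIV) * (\<integral>\<^sup>+c. ennreal (?w c) \<partial>count_space UNIV)))"
    by (simp add: nn_integral_fst_count_space[symmetric] nn_integral_cmult nn_integral_multc)
  also have "\<dots> < top"
    using nn_integral_int_powr_finite[OF \<open>\<delta> > 0\<close>] by (simp add: ennreal_mult_less_top)
  finally show ?thesis .
qed

section \<open>The uniform Sobolev bound\<close>

lemma epow_mono: "x \<le> y \<Longrightarrow> a \<ge> 0 \<Longrightarrow> epow x a \<le> epow y a"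
  unfolding epow_def
  by (auto simp: top_unique less_top intro!: ennreal_leI powr_mono2 enn2real_mono)

lemma H_norm_sq_le:
  assumes "v \<in> Lp_space P 2"
  shows "epow (H_norm P \<alpha> v) 2
    \<le> (\<integral>\<^sup>+k. ennreal ((1 + (norm k)\<^sup>2) powr \<alpha> * (norm (fourier P v k))\<^sup>2) \<partial>count_space (wave_vectors P))"
  unfolding H_norm_def using assms infsum_le_nn_integral_count_space by (simp add: epow_inverse)

lemma countable_wave_vectors: "P > 0 \<Longrightarrow> countable (wave_vectors P)"
  using bij_betw_imp_surj_on[OF bij_betw_wave_vector, of P] countable_image[of UNIV "wave_vector P"]
  by simp

text \<open>For n >= \<kappa>, 1 + n <= (1 + 1/\<kappa>) n reduces to the Kolmogorov bound; for n <
  \<kappa>, 1 + n <= 1 + \<kappa> reduces to the energy bound. Adding the two constants gives one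
  estimate for all modes. The Sobolev weight is handled by 1 + n^2 <= (1 + n)^2, and \<gamma> will
  be 3 + \<beta>.\<close>

lemma mode_bound:
  fixes n \<kappa> :: real and I :: ennreal
  assumes "n \<ge> 0" "\<kappa> > 0" "\<gamma> > 0" "M \<ge> 0" "C \<ge> 0" "\<alpha> \<ge> 0"
    and all: "I \<le> ennreal M"
    and high: "n \<ge> \<kappa> \<Longrightarrow> ennreal (n powr \<gamma>) * I \<le> ennreal C"
  shows "ennreal ((1 + n\<^sup>2) powr \<alpha>) * I
    \<le> ennreal ((1 + 1 / \<kappa>) powr \<gamma> * C + (1 + \<kappa>) powr \<gamma> * M) * ennreal ((1 + n) powr (2 * \<alpha> - \<gamma>))"
proof -
  obtain r where r: "I = ennreal r" "r \<ge> 0"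
    using all by (cases I) (auto simp: top_unique)
  have rM: "r \<le> M" using all r assms by simp
  have "(1 + n) powr \<gamma> * r \<le> (1 + 1 / \<kappa>) powr \<gamma> * C + (1 + \<kappa>) powr \<gamma> * M"
  proof (cases "n \<ge> \<kappa>")
    case True
    have "n powr \<gamma> * r \<le> C"
      using high[OF True] r assms by (simp add: ennreal_mult'[symmetric])
    moreover have "1 + n \<le> (1 + 1 / \<kappa>) * n"
      using True assms by (simp add: field_simps)
    then have "(1 + n) powr \<gamma> \<le> (1 + 1 / \<kappa>) powr \<gamma> * n powr \<gamma>"
      using assms by (subst powr_mult[symmetric]) (auto intro!: powr_mono2)
    then have "(1 + n) powr \<gamma> * r \<le> (1 + 1 / \<kappa>) powr \<gamma> * n powr \<gamma> * r"
      using r by (intro mult_right_mono)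
    ultimately have "(1 + n) powr \<gamma> * r \<le> (1 + 1 / \<kappa>) powr \<gamma> * C"
      using mult_left_mono[of "n powr \<gamma> * r" C "(1 + 1 / \<kappa>) powr \<gamma>"] by (simp add: mult.assoc)
    moreover have "(1 + \<kappa>) powr \<gamma> * M \<ge> 0" using assms by simp
    ultimately show ?thesis by linarith
  next
    case False
    then have "(1 + n) powr \<gamma> * r \<le> (1 + \<kappa>) powr \<gamma> * M"
      using assms r rM by (intro mult_mono powr_mono2) auto
    moreover have "(1 + 1 / \<kappa>) powr \<gamma> * C \<ge> 0" using assms by simp
    ultimately show ?thesis by linarith
  qed
  then have "(1 + n) powr (2 * \<alpha> - \<gamma>) * ((1 + n) powr \<gamma> * r)
      \<le> (1 + n) powr (2 * \<alpha> - \<gamma>) * ((1 + 1 / \<kappa>) powr \<gamma> * C + (1 + \<kappa>) powr \<gamma> * M)"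
    by (intro mult_left_mono) auto
  moreover have "(1 + n\<^sup>2) powr \<alpha> * r \<le> (1 + n) powr (2 * \<alpha>) * r"
  proof -
    have "(1 + n\<^sup>2) powr \<alpha> \<le> ((1 + n)\<^sup>2) powr \<alpha>"
      using assms by (intro powr_mono2) (auto simp: power2_sum)
    also have "\<dots> = (1 + n) powr (2 * \<alpha>)"
      using powr_powr[of "1 + n" 2 \<alpha>] \<open>n \<ge> 0\<close> by (simp add: powr_numeral)
    finally show ?thesis using r by (intro mult_right_mono)
  qed
  moreover have "(1 + n) powr (2 * \<alpha> - \<gamma>) * ((1 + n) powr \<gamma> * r) = (1 + n) powr (2 * \<alpha>) * r"
    using \<open>n \<ge> 0\<close> by (simp add: powr_add[symmetric] mult.assoc[symmetric])
  ultimately have le: "(1 + n\<^sup>2) powr \<alpha> * r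
      \<le> ((1 + 1 / \<kappa>) powr \<gamma> * C + (1 + \<kappa>) powr \<gamma> * M) * (1 + n) powr (2 * \<alpha> - \<gamma>)"
    by (simp only: mult.commute[of _ "(1 + n) powr (2 * \<alpha> - \<gamma>)"])
  have "ennreal ((1 + n\<^sup>2) powr \<alpha>) * I = ennreal ((1 + n\<^sup>2) powr \<alpha> * r)"
    unfolding r(1) by (intro ennreal_mult'[symmetric]) simp
  also have "\<dots> \<le> ennreal (((1 + 1 / \<kappa>) powr \<gamma> * C + (1 + \<kappa>) powr \<gamma> * M) * (1 + n) powr (2 * \<alpha> - \<gamma>))"
    by (rule ennreal_leI[OF le])
  also have "\<dots> = ennreal ((1 + 1 / \<kappa>) powr \<gamma> * C + (1 + \<kappa>) powr \<gamma> * M) * ennreal ((1 + n) powr (2 * \<alpha> - \<gamma>))"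
    using assms by (intro ennreal_mult') (intro add_nonneg_nonneg mult_nonneg_nonneg; simp)
  finally show ?thesis .
qed

theorem proposition3p1:
  fixes P \<beta> :: real
    and u\<^sub>0 :: "real^3 \<Rightarrow> real^3"
    and f :: "real \<Rightarrow> real^3 \<Rightarrow> real^3"
    and u :: "real \<Rightarrow> real \<Rightarrow> real^3 \<Rightarrow> real^3"
    and \<pi> :: "real \<Rightarrow> real \<Rightarrow> real^3 \<Rightarrow> real"
  assumes "P > 0" and "\<beta> > 0"
    and initial_data: "u\<^sub>0 \<in> Lp_space P 2"
    and force: "\<And>T. T > 0 \<Longrightarrow> Lt_Lp P T 2 2 f"
    and solutions: "\<And>\<mu>. \<mu> > 0 \<Longrightarrow> ns_weak_solution P u\<^sub>0 f \<mu> (u \<mu>) (\<pi> \<mu>)"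
    and kolmogorov: "K41w P \<beta> u"
  shows "\<forall>T>0. \<forall>\<alpha>. 0 < \<alpha> \<and> \<alpha> < \<beta> / 2 \<longrightarrow>
           (\<exists>M>0. \<forall>\<mu>>0. Lt_norm 2 T (H_norm P \<alpha>) (u \<mu>) \<le> ennreal M)"
proof (intro allI impI)
  fix T \<alpha> :: real assume "T > 0" and \<alpha>: "0 < \<alpha> \<and> \<alpha> < \<beta> / 2"
  obtain C \<kappa> where "C > 0" "\<kappa> > 0" and K41: "\<And>\<mu>. \<mu> > 0 \<Longrightarrow>
      (SUP k\<in>{k\<in>wave_vectors P. norm k \<ge> \<kappa>}. ennreal (norm k powr (3 + \<beta>)) *
        (\<integral>\<^sup>+t\<in>{0<..<T}. ennreal ((norm (fourier P (u \<mu> t) k))\<^sup>2) \<partial>lborel)) \<le> ennreal C"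
    using kolmogorov \<open>T > 0\<close> unfolding K41w_def by meson
  obtain E where E: "\<And>\<mu>. \<mu> > 0 \<Longrightarrow> (\<integral>\<^sup>+t\<in>{0<..<T}. energy P (u \<mu> t) \<partial>lborel) \<le> ennreal E"
    using energy_bound_uniform[OF \<open>P > 0\<close> \<open>T > 0\<close> force] solutions by meson
  \<comment> \<open>The bound of \<open>fourier_bound\<close> integrated in time. Nothing is known
    about the sign of \<open>E\<close>, hence the maximum with 0.\<close>
  define M where "M = 3 / P ^ 3 * max E 0"
  have "M \<ge> 0" using \<open>P > 0\<close> by (simp add: M_def)
  define A where "A = (1 + 1 / \<kappa>) powr (3 + \<beta>) * C + (1 + \<kappa>) powr (3 + \<beta>) * M"
  have "A \<ge> 0" using \<open>C > 0\<close> \<open>M \<ge> 0\<close> by (simp add: A_def)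
  have "(\<integral>\<^sup>+k. ennreal ((1 + norm k) powr (2 * \<alpha> - (3 + \<beta>))) \<partial>count_space (wave_vectors P)) < top"
  proof -
    \<comment> \<open>The condition \<alpha> < \<beta> / 2 is exactly positivity of the \<delta>
      that \<open>lattice_sum_finite\<close> requires here.\<close>
    have "2 * \<alpha> - (3 + \<beta>) = - (3 + 3 * ((\<beta> - 2 * \<alpha>) / 3))" by (simp add: field_simps)
    moreover have "(\<beta> - 2 * \<alpha>) / 3 > 0" using \<alpha> by simp
    ultimately show ?thesis
      using lattice_sum_finite[OF \<open>P > 0\<close>, of "(\<beta> - 2 * \<alpha>) / 3"] by (simp only:)
  qed
  then obtain L where L: "L \<ge> 0"
    "(\<integral>\<^sup>+k. ennreal ((1 + norm k) powr (2 * \<alpha> - (3 + \<beta>))) \<partial>count_space (wave_vectors P)) = ennreal L"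
    by (auto simp: less_top_ennreal)
  \<comment> \<open>\<open>A\<close> and \<open>L\<close> were fixed before \<mu>. The added 1 makes
    the bound visibly positive.\<close>
  have "Lt_norm 2 T (H_norm P \<alpha>) (u \<mu>) \<le> ennreal ((A * L) powr (1 / 2) + 1)" if "\<mu> > 0" for \<mu>
  proof -
    have u: "st_field P (u \<mu>)" using solutions[OF that] by (simp add: ns_weak_solution_def)
    have "C_L2w P T (u \<mu>)"
      using solutions[OF that] \<open>T > 0\<close> unfolding ns_weak_solution_def by blast
    \<comment> \<open>\<open>H_norm\<close> is infinite off \<open>Lp_space P 2\<close>, so its
      Fourier series is accessible only after membership is known at every time in (0, T).\<close>
    then have uL: "u \<mu> t \<in> Lp_space P 2" if "t \<in> {0<..<T}" for t
      using that by (simp add: C_L2w_def)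
    define I where "I k = (\<integral>\<^sup>+t\<in>{0<..<T}. ennreal ((norm (fourier P (u \<mu> t) k))\<^sup>2) \<partial>lborel)" for k
    have IM: "I k \<le> ennreal M" for k
    proof -
      have "I k \<le> (\<integral>\<^sup>+t. ennreal (3 / P ^ 3) * (energy P (u \<mu> t) * indicator {0<..<T} t) \<partial>lborel)"
        unfolding I_def
      proof (intro nn_integral_mono)
        fix t show "ennreal ((norm (fourier P (u \<mu> t) k))\<^sup>2) * indicator {0<..<T} t
            \<le> ennreal (3 / P ^ 3) * (energy P (u \<mu> t) * indicator {0<..<T} t)"
          using fourier_bound[OF \<open>P > 0\<close> st_field_section[OF u], of t k]
          by (simp split: split_indicator)
      qed
      also have "\<dots> = ennreal (3 / P ^ 3) * (\<integral>\<^sup>+t\<in>{0<..<T}. energy P (u \<mu> t) \<partial>lborel)"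
        using energy_measurable[OF u] by (intro nn_integral_cmult) simp
      also have "\<dots> \<le> ennreal (3 / P ^ 3) * ennreal (max E 0)"
        by (intro mult_left_mono order_trans[OF E[OF that]] ennreal_leI) auto
      also have "\<dots> = ennreal M"
        unfolding M_def using \<open>P > 0\<close> by (intro ennreal_mult'[symmetric]) simp
      finally show ?thesis .
    qed
    have mode: "ennreal ((1 + (norm k)\<^sup>2) powr \<alpha>) * I k
        \<le> ennreal A * ennreal ((1 + norm k) powr (2 * \<alpha> - (3 + \<beta>)))" if "k \<in> wave_vectors P" for k
      unfolding A_def
    proof (rule mode_bound)
      show "ennreal (norm k powr (3 + \<beta>)) * I k \<le> ennreal C" if "\<kappa> \<le> norm k"
        unfolding I_def using K41[OF \<open>\<mu> > 0\<close>] \<open>k \<in> wave_vectors P\<close> that by (simp add: SUP_le_iff)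
    qed (use \<alpha> \<open>\<beta> > 0\<close> \<open>\<kappa> > 0\<close> \<open>C > 0\<close> \<open>M \<ge> 0\<close> IM in auto)
    let ?a = "\<lambda>k t. ennreal ((1 + (norm k)\<^sup>2) powr \<alpha>) * (ennreal ((norm (fourier P (u \<mu> t) k))\<^sup>2) * indicator {0<..<T} t)"
    have m: "(\<lambda>t. ennreal ((norm (fourier P (u \<mu> t) k))\<^sup>2) * indicator {0<..<T} t) \<in> borel_measurable lborel" for k
      using fourier_measurable[OF u] by simp
    have "(\<integral>\<^sup>+t\<in>{0<..<T}. epow (H_norm P \<alpha> (u \<mu> t)) 2 \<partial>lborel)
        \<le> (\<integral>\<^sup>+t. \<integral>\<^sup>+k. ?a k t \<partial>count_space (wave_vectors P) \<partial>lborel)"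
    proof (intro nn_integral_mono)
      fix t show "epow (H_norm P \<alpha> (u \<mu> t)) 2 * indicator {0<..<T} t
          \<le> (\<integral>\<^sup>+k. ?a k t \<partial>count_space (wave_vectors P))"
        using H_norm_sq_le[OF uL, of t \<alpha>] by (simp add: ennreal_mult split: split_indicator)
    qed
    \<comment> \<open>Tonelli over the countable lattice: both available bounds concern the time
      integral of one fixed mode, so the time integration has to be performed first.\<close>
    also have "\<dots> = (\<integral>\<^sup>+k. \<integral>\<^sup>+t. ?a k t \<partial>lborel \<partial>count_space (wave_vectors P))"
      using m by (intro nn_integral_count_space_nn_integral countable_wave_vectors \<open>P > 0\<close> borel_measurable_times) auto
    also have "\<dots> = (\<integral>\<^sup>+k. ennreal ((1 + (norm k)\<^sup>2) powr \<alpha>) * I k \<partial>count_space (wave_vectors P))"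
      unfolding I_def by (intro nn_integral_cong nn_integral_cmult m)
    also have "\<dots> \<le> (\<integral>\<^sup>+k. ennreal A * ennreal ((1 + norm k) powr (2 * \<alpha> - (3 + \<beta>))) \<partial>count_space (wave_vectors P))"
      by (intro nn_integral_mono mode) simp
    also have "\<dots> = ennreal (A * L)"
      using L \<open>A \<ge> 0\<close> by (simp add: nn_integral_cmult ennreal_mult')
    finally have "Lt_norm 2 T (H_norm P \<alpha>) (u \<mu>) \<le> epow (ennreal (A * L)) (1 / 2)"
      unfolding Lt_norm_def by (rule epow_mono) simp
    also have "\<dots> \<le> ennreal ((A * L) powr (1 / 2) + 1)"
      using \<open>A \<ge> 0\<close> \<open>L \<ge> 0\<close> by (simp add: epow_def ennreal_leI)
    finally show ?thesis .
  qed
  moreover have "(A * L) powr (1 / 2) + 1 > 0"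
    using powr_ge_zero[of "A * L" "1 / 2"] by linarith
  ultimately show "\<exists>M>0. \<forall>\<mu>>0. Lt_norm 2 T (H_norm P \<alpha>) (u \<mu>) \<le> ennreal M" by blast
qed

end
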